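(* Let $R$ be a commutative ring with identity, let $S$ be a multiplicative subset of $R$, and let $0\longrightarrow M'\stackrel{f}{\longrightarrow} M\stackrel{g}{\longrightarrow} M''\longrightarrow 0$ be an exact sequence of $R$-modules. The following assertions hold: 1. If $M'$ and $M''$ are $S$-finite, then $M$ is $S$-finite. In particular, every finite direct sum of $S$-finite modules is $S$-finite. 2. If $M'$ and $M''$ are $S$-finitely presented, then $M$ is $S$-finitely presented. In particular, every finite direct sum of $S$-finitely presented modules is $S$-finitely presented. 3. If $M$ is $S$-finite, then $M''$ is $S$-finite. In particular, a direct summand of an $S$-finite module is $S$-finite. 4. If $M'$ is $S$-finite and $M$ is $S$-finitely presented, then $M''$ is $S$-finitely presented. 5. If $M''$ is $S$-finitely presented and $M$ is $S$-finite, then $M'$ is $S$-finite.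
   Context: All rings are commutative with identity and all modules are unitary. A multiplicative subset of $R$ is a subset containing $1$ and closed under multiplication. An $R$-module $M$ is $S$-finite if there exist a finitely generated submodule $N$ of $M$ and $s\in S$ such that $sM\subseteq N$. An $R$-module $M$ is $S$-finitely presented if there exists an exact sequence of $R$-modules $0\to K\to F\to M\to 0$ with $K$ an $S$-finite module and $F$ a finitely generated free module. *)

theory Defs
  imports "HOL-Algebra.Module" "HOL-Algebra.AbelCoset" "HOL.Hull"
begin

text \<open>
  Modules are those of \<^theory>\<open>HOL-Algebra.Module\<close>; the ring-multiplication fields of a module
  record carry no meaning. A submodule \<open>N\<close> of \<open>M\<close>, viewed as a module, is \<open>M\<lparr>carrier := N\<rparr>\<close>.
\<close>

definition linear_maps ::
  "('a, 'r) ring_scheme \<Rightarrow> ('a, 'b, 'm) module_scheme \<Rightarrow> ('a, 'c, 'n) module_scheme \<Rightarrow> ('b \<Rightarrow> 'c) set"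
where
  "linear_maps R M N = {h \<in> hom (add_monoid M) (add_monoid N).
     \<forall>a\<in>carrier R. \<forall>x\<in>carrier M. h (a \<odot>\<^bsub>M\<^esub> x) = a \<odot>\<^bsub>N\<^esub> h x}"

definition short_exact ::
  "('a, 'r) ring_scheme \<Rightarrow> ('a, 'b, 'k) module_scheme \<Rightarrow> ('a, 'c, 'm) module_scheme \<Rightarrow>
   ('a, 'd, 'n) module_scheme \<Rightarrow> ('b \<Rightarrow> 'c) \<Rightarrow> ('c \<Rightarrow> 'd) \<Rightarrow> bool"
where
  "short_exact R A B C f g \<longleftrightarrow>
     module R A \<and> module R B \<and> module R C \<and>
     f \<in> linear_maps R A B \<and> g \<in> linear_maps R B C \<and>
     inj_on f (carrier A) \<and> f ` carrier A = a_kernel B C g \<and> g ` carrier B = carrier C"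

definition finitely_generated :: "('a, 'r) ring_scheme \<Rightarrow> ('a, 'b, 'm) module_scheme \<Rightarrow> bool" where
  "finitely_generated R M \<longleftrightarrow>
     (\<exists>X. finite X \<and> X \<subseteq> carrier M \<and> (\<lambda>N. submodule N R M) hull X = carrier M)"

text \<open>
  A module is free if it has a basis \<open>B\<close>, i.e. every element is a linear combination of elements of
  \<open>B\<close> with a unique finitely supported family of coefficients.
\<close>

definition free_module :: "('a, 'r) ring_scheme \<Rightarrow> ('a, 'b, 'm) module_scheme \<Rightarrow> bool" where
  "free_module R M \<longleftrightarrow>
     (\<exists>B \<subseteq> carrier M. \<forall>x\<in>carrier M. \<exists>!c. c \<in> B \<rightarrow>\<^sub>E carrier R \<and>
        finite {b \<in> B. c b \<noteq> \<zero>\<^bsub>R\<^esub>} \<and> x = (\<Oplus>\<^bsub>M\<^esub>b\<in>{b \<in> B. c b \<noteq> \<zero>\<^bsub>R\<^esub>}. c b \<odot>\<^bsub>M\<^esub> b))"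

definition S_finite :: "('a, 'r) ring_scheme \<Rightarrow> 'a set \<Rightarrow> ('a, 'b, 'm) module_scheme \<Rightarrow> bool" where
  "S_finite R S M \<longleftrightarrow>
     (\<exists>N s. submodule N R M \<and> finitely_generated R (M\<lparr>carrier := N\<rparr>) \<and>
        s \<in> S \<and> (\<lambda>x. s \<odot>\<^bsub>M\<^esub> x) ` carrier M \<subseteq> N)"

text \<open>
  HOL cannot quantify existentially over the carrier types of \<open>K\<close> and \<open>F\<close>, so both are taken on
  the type \<open>nat \<Rightarrow> 'a\<close>. This loses no generality: a finitely generated free module is isomorphic
  to some \<open>R\<^sup>n\<close>, whose elements are (extensional) functions from \<open>{..<n}\<close> to \<open>R\<close>, and \<open>K\<close> is
  isomorphic to a submodule of it.
\<close>

definition S_finitely_presented ::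
  "('a, 'r) ring_scheme \<Rightarrow> 'a set \<Rightarrow> ('a, 'b, 'm) module_scheme \<Rightarrow> bool"
where
  "S_finitely_presented R S M \<longleftrightarrow>
     (\<exists>(K :: ('a, nat \<Rightarrow> 'a) module) (F :: ('a, nat \<Rightarrow> 'a) module) i p.
        short_exact R K F M i p \<and> S_finite R S K \<and> finitely_generated R F \<and> free_module R F)"

text \<open>The external direct sum; elements are extensional functions on the index set.\<close>

definition direct_sum :: "'i set \<Rightarrow> ('i \<Rightarrow> ('a, 'b, 'm) module_scheme) \<Rightarrow> ('a, 'i \<Rightarrow> 'b) module" where
  "direct_sum I N =
     \<lparr>carrier = {x \<in> \<Pi>\<^sub>E i\<in>I. carrier (N i). finite {i \<in> I. x i \<noteq> \<zero>\<^bsub>N i\<^esub>}},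
      mult = (\<lambda>x y. \<lambda>i\<in>I. x i \<otimes>\<^bsub>N i\<^esub> y i),
      one = (\<lambda>i\<in>I. \<one>\<^bsub>N i\<^esub>),
      zero = (\<lambda>i\<in>I. \<zero>\<^bsub>N i\<^esub>),
      add = (\<lambda>x y. \<lambda>i\<in>I. x i \<oplus>\<^bsub>N i\<^esub> y i),
      smult = (\<lambda>a x. \<lambda>i\<in>I. a \<odot>\<^bsub>N i\<^esub> x i)\<rparr>"

definition direct_summand :: "'b set \<Rightarrow> ('a, 'r) ring_scheme \<Rightarrow> ('a, 'b, 'm) module_scheme \<Rightarrow> bool" where
  "direct_summand N R M \<longleftrightarrow> submodule N R M \<and>
     (\<exists>Q. submodule Q R M \<and> N <+>\<^bsub>M\<^esub> Q = carrier M \<and> N \<inter> Q = {\<zero>\<^bsub>M\<^esub>})"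

end

theory Submission
  imports Defs
begin

text \<open>
  The key fact is the last assertion: if \<open>F \<rightarrow> M''\<close> is a presentation with \<open>S\<close>-finite kernel \<open>K\<close>, a lift
  \<open>q : F \<rightarrow> M\<close> restricts to \<open>K \<rightarrow> M'\<close> with \<open>M' / q(K)\<close> isomorphic to \<open>M / q(F)\<close>, so that \<open>M'\<close> is an
  extension of \<open>S\<close>-finite modules. For surjections \<open>F \<rightarrow> M \<rightarrow> M''\<close>, the kernel of the composition is an
  extension of \<open>M'\<close> by the kernel of \<open>F \<rightarrow> M\<close>; this yields the assertions on finite presentation from
  those on \<open>S\<close>-finiteness. Direct sums are iterated extensions.
\<close>

section \<open>Spans and linear maps\<close>

text \<open>The isomorphism behind the last assertion is the second isomorphism theorem:
  \<open>M\<close> is the sum of \<open>f M'\<close> and \<open>q F\<close>, because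
  \<open>g q = p\<close> is onto, and these two meet exactly in the image of \<open>K\<close>. No
  quotient module is formed, though. Membership in spans is tracked with explicit multipliers, and
  each extension multiplies the two multipliers at hand, which is where closure of \<open>S\<close>
  under products enters. The other constraint is the carrier type fixed in
  \<open>S_finitely_presented\<close>: free modules built by hand have to live on functions from
  numbers to scalars, hence covers by powers of the ring and kernels cut out of them.\<close>

abbreviation lin_span where
  "lin_span R M X \<equiv> (\<lambda>N. submodule N R M) hull X"

text \<open>Negation is multiplication by \<open>-1\<close>, so closure under scalars gives closure
  under negatives.\<close>

lemma (in module) submodule_iff:
  "submodule H R M \<longleftrightarrow> H \<subseteq> carrier M \<and> \<zero>\<^bsub>M\<^esub> \<in> H \<and> (\<forall>x\<in>H. \<forall>y\<in>H. x \<oplus>\<^bsub>M\<^esub> y \<in> H) \<and>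
     (\<forall>a\<in>carrier R. \<forall>x\<in>H. a \<odot>\<^bsub>M\<^esub> x \<in> H)"
  (is "_ \<longleftrightarrow> ?rhs")
proof
  assume H: "submodule H R M"
  interpret H: submodule H R M by (fact H)
  show ?rhs using submoduleE[OF H] H.one_closed by auto
next
  assume H: ?rhs
  show "submodule H R M"
  proof (rule submoduleI)
    fix x assume x: "x \<in> H"
    have "\<ominus>\<^bsub>M\<^esub> x = (\<ominus> \<one>) \<odot>\<^bsub>M\<^esub> x" using x H by (subst smult_l_minus) auto
    then show "\<ominus>\<^bsub>M\<^esub> x \<in> H" using x H by simp
  qed (use H in auto)
qed

text \<open>The carrier itself is one of the submodules being intersected, so the hull does not
  escape the module; intersections preserve the closure conditions.\<close>

lemma (in module) submodule_lin_span:
  assumes "X \<subseteq> carrier M"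
  shows "submodule (lin_span R M X) R M"
proof -
  have "carrier M \<in> {N. submodule N R M \<and> X \<subseteq> N}"
    using carrier_is_submodule assms by auto
  then show ?thesis
    unfolding hull_def by (subst submodule_iff) (auto simp: submodule_iff)
qed

lemma (in module) lin_span_closed:
  assumes "X \<subseteq> carrier M"
  shows "lin_span R M X \<subseteq> carrier M"
    and "x \<in> lin_span R M X \<Longrightarrow> y \<in> lin_span R M X \<Longrightarrow> x \<oplus>\<^bsub>M\<^esub> y \<in> lin_span R M X"
    and "a \<in> carrier R \<Longrightarrow> x \<in> lin_span R M X \<Longrightarrow> a \<odot>\<^bsub>M\<^esub> x \<in> lin_span R M X"
  using submodule_lin_span[OF assms] unfolding submodule_iff[of "lin_span R M X"] by auto

lemma (in module) submodule_restrict_iff: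
  assumes "submodule N R M"
  shows "submodule H R (M\<lparr>carrier := N\<rparr>) \<longleftrightarrow> H \<subseteq> N \<and> submodule H R M"
proof -
  interpret N: module R "M\<lparr>carrier := N\<rparr>"
    using assms submodule.submodule_is_module module_axioms by blast
  show ?thesis
    using assms unfolding submodule_iff N.submodule_iff by auto
qed

text \<open>This removes the modified record from the definition of S-finiteness: generators of a
  submodule can be handled in the ambient module.\<close>

lemma (in module) lin_span_restrict:
  assumes N: "submodule N R M" and "X \<subseteq> N"
  shows "lin_span R (M\<lparr>carrier := N\<rparr>) X = lin_span R M X"
proof -
  have X: "X \<subseteq> carrier M" using assms submodule_iff by auto
  have "lin_span R M X \<subseteq> N" using assms by (intro hull_minimal)
  then have "submodule (lin_span R M X) R (M\<lparr>carrier := N\<rparr>)"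
    unfolding submodule_restrict_iff[OF N] using submodule_lin_span[OF X] by blast
  then show ?thesis
    by (intro hull_unique hull_subset hull_minimal) (use submodule_restrict_iff[OF N] in blast)+
qed

text \<open>The witnessing submodule may be taken to be the span of its own finite set of
  generators. The later arguments use this form: finitely many elements and one multiplier.\<close>

lemma (in module) S_finite_iff:
  "S_finite R S M \<longleftrightarrow>
     (\<exists>X s. finite X \<and> X \<subseteq> carrier M \<and> s \<in> S \<and> (\<forall>x\<in>carrier M. s \<odot>\<^bsub>M\<^esub> x \<in> lin_span R M X))"
  (is "_ \<longleftrightarrow> ?rhs")
proof
  assume "S_finite R S M"
  then obtain N s X where N: "submodule N R M" and s: "s \<in> S" "(\<lambda>x. s \<odot>\<^bsub>M\<^esub> x) ` carrier M \<subseteq> N"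
    and X: "finite X" "X \<subseteq> N" "lin_span R (M\<lparr>carrier := N\<rparr>) X = N"
    unfolding S_finite_def finitely_generated_def by auto
  have "X \<subseteq> carrier M" using N X(2) unfolding submodule_iff by auto
  moreover have "lin_span R M X = N" using lin_span_restrict[OF N X(2)] X(3) by simp
  ultimately show ?rhs
    using X(1) s by (intro exI[of _ X] exI[of _ s]) (simp add: image_subset_iff)
next
  assume ?rhs
  then obtain X s where X: "finite X" "X \<subseteq> carrier M" and s: "s \<in> S"
    "\<forall>x\<in>carrier M. s \<odot>\<^bsub>M\<^esub> x \<in> lin_span R M X" by blast
  have N: "submodule (lin_span R M X) R M" using X by (intro submodule_lin_span)
  have "X \<subseteq> lin_span R M X" by (rule hull_subset)
  then have "finitely_generated R (M\<lparr>carrier := lin_span R M X\<rparr>)"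
    using X(1) lin_span_restrict[OF N, of X] unfolding finitely_generated_def
    by (intro exI[of _ X]) simp
  then show "S_finite R S M"
    unfolding S_finite_def using N s by (intro exI[of _ "lin_span R M X"] exI[of _ s]) (simp add: image_subset_iff)
qed

lemma (in module) S_finite_if_finitely_generated:
  assumes "submonoid S R" and "finitely_generated R M"
  shows "S_finite R S M"
proof -
  obtain X where "finite X" "X \<subseteq> carrier M" "lin_span R M X = carrier M"
    using assms(2) unfolding finitely_generated_def by blast
  then show ?thesis
    unfolding S_finite_iff using submonoid.one_closed[OF assms(1)]
    by (intro exI[of _ X] exI[of _ \<one>]) simp
qed

section \<open>Linear maps and their effect on spans\<close>

lemma linear_maps_iff:
  "h \<in> linear_maps R M N \<longleftrightarrow>
     (\<forall>x\<in>carrier M. h x \<in> carrier N) \<and>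
     (\<forall>x\<in>carrier M. \<forall>y\<in>carrier M. h (x \<oplus>\<^bsub>M\<^esub> y) = h x \<oplus>\<^bsub>N\<^esub> h y) \<and>
     (\<forall>a\<in>carrier R. \<forall>x\<in>carrier M. h (a \<odot>\<^bsub>M\<^esub> x) = a \<odot>\<^bsub>N\<^esub> h x)"
  by (auto simp: linear_maps_def hom_def Pi_iff)

locale linear_map = M: module R M + N: module R N
  for R (structure) and M (structure) and N (structure) and h +
  assumes linear: "h \<in> linear_maps R M N"
begin

lemma map_closed [simp]: "x \<in> carrier M \<Longrightarrow> h x \<in> carrier N"
  and map_add: "x \<in> carrier M \<Longrightarrow> y \<in> carrier M \<Longrightarrow> h (x \<oplus>\<^bsub>M\<^esub> y) = h x \<oplus>\<^bsub>N\<^esub> h y"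
  and map_smult: "a \<in> carrier R \<Longrightarrow> x \<in> carrier M \<Longrightarrow> h (a \<odot>\<^bsub>M\<^esub> x) = a \<odot>\<^bsub>N\<^esub> h x"
  using linear by (simp_all add: linear_maps_iff)

lemma map_zero [simp]: "h \<zero>\<^bsub>M\<^esub> = \<zero>\<^bsub>N\<^esub>"
  using map_smult[of "\<zero>\<^bsub>R\<^esub>" "\<zero>\<^bsub>M\<^esub>"] by simp

lemma map_neg: "x \<in> carrier M \<Longrightarrow> h (\<ominus>\<^bsub>M\<^esub> x) = \<ominus>\<^bsub>N\<^esub> h x"
  using map_smult[of "\<ominus>\<^bsub>R\<^esub> \<one>\<^bsub>R\<^esub>" x] by (simp add: M.smult_l_minus N.smult_l_minus)

lemma map_diff: "x \<in> carrier M \<Longrightarrow> y \<in> carrier M \<Longrightarrow> h (x \<ominus>\<^bsub>M\<^esub> y) = h x \<ominus>\<^bsub>N\<^esub> h y"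
  by (simp add: a_minus_def map_add map_neg)

lemma map_finsum:
  assumes "v \<in> T \<rightarrow> carrier M"
  shows "h (\<Oplus>\<^bsub>M\<^esub>b\<in>T. v b) = (\<Oplus>\<^bsub>N\<^esub>b\<in>T. h (v b))"
proof (cases "finite T")
  case True
  then show ?thesis using assms
    by (induction T) (auto simp: Pi_iff map_add)
qed simp

lemma submodule_image:
  assumes "submodule H R M"
  shows "submodule (h ` H) R N"
proof -
  have H: "H \<subseteq> carrier M" using assms M.submodule_iff by auto
  have "h x \<oplus>\<^bsub>N\<^esub> h y \<in> h ` H" if "x \<in> H" "y \<in> H" for x y
    using that assms H by (subst map_add[symmetric]) (auto simp: M.submodule_iff)
  moreover have "a \<odot>\<^bsub>N\<^esub> h x \<in> h ` H" if "a \<in> carrier R" "x \<in> H" for a x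
    using that assms H by (subst map_smult[symmetric]) (auto simp: M.submodule_iff)
  moreover have "\<zero>\<^bsub>N\<^esub> \<in> h ` H"
    using assms map_zero unfolding M.submodule_iff by (metis imageI)
  ultimately show ?thesis using H by (auto simp: N.submodule_iff)
qed

lemma submodule_vimage:
  assumes "submodule H R N"
  shows "submodule {x \<in> carrier M. h x \<in> H} R M"
  using assms by (auto simp: M.submodule_iff N.submodule_iff map_add map_smult)

lemma submodule_kernel: "submodule (a_kernel M N h) R M"
  by (auto simp: a_kernel_def' M.submodule_iff map_add map_smult)

text \<open>Both inclusions are minimality of a span: preimages and images of submodules are
  submodules.\<close>

lemma image_lin_span:
  assumes "X \<subseteq> carrier M"
  shows "h ` lin_span R M X = lin_span R N (h ` X)"
proof
  have hX: "h ` X \<subseteq> carrier N" using assms by auto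
  have "lin_span R M X \<subseteq> {x \<in> carrier M. h x \<in> lin_span R N (h ` X)}"
    using submodule_vimage[OF N.submodule_lin_span[OF hX]] assms
    by (intro hull_minimal) (auto intro: hull_inc)
  then show "h ` lin_span R M X \<subseteq> lin_span R N (h ` X)" by auto
  show "lin_span R N (h ` X) \<subseteq> h ` lin_span R M X"
    using submodule_image[OF M.submodule_lin_span[OF assms]]
    by (intro hull_minimal) (auto intro: hull_inc)
qed

text \<open>The multiplier is kept and the generators are pushed forward.\<close>

lemma S_finite_image:
  assumes "S_finite R S M" and S: "S \<subseteq> carrier R" and surj: "h ` carrier M = carrier N"
  shows "S_finite R S N"
proof -
  obtain X s where X: "finite X" "X \<subseteq> carrier M" and s: "s \<in> S"
    "\<forall>x\<in>carrier M. s \<odot>\<^bsub>M\<^esub> x \<in> lin_span R M X"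
    using assms M.S_finite_iff by auto
  have "s \<odot>\<^bsub>N\<^esub> h x \<in> lin_span R N (h ` X)" if "x \<in> carrier M" for x
    using that s S image_lin_span[OF X(2)] by (subst map_smult[symmetric]) auto
  then have "\<forall>y\<in>carrier N. s \<odot>\<^bsub>N\<^esub> y \<in> lin_span R N (h ` X)"
    unfolding surj[symmetric] by blast
  then show ?thesis using X s by (subst N.S_finite_iff) (intro exI[of _ "h ` X"] exI[of _ s], auto)
qed

lemma finitely_generated_image:
  assumes "finitely_generated R M" and "h ` carrier M = carrier N"
  shows "finitely_generated R N"
proof -
  obtain X where "finite X" "X \<subseteq> carrier M" "lin_span R M X = carrier M"
    using assms unfolding finitely_generated_def by blast
  then show ?thesis
    unfolding finitely_generated_def using assms(2) image_lin_span[of X]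
    by (intro exI[of _ "h ` X"]) auto
qed

lemma short_exact_kernel:
  assumes "h ` carrier M = carrier N"
  shows "short_exact R (M\<lparr>carrier := a_kernel M N h\<rparr>) M N (\<lambda>x. x) h"
proof -
  have "module R (M\<lparr>carrier := a_kernel M N h\<rparr>)"
    using submodule.submodule_is_module[OF submodule_kernel] M.module_axioms .
  moreover have "(\<lambda>x. x) \<in> linear_maps R (M\<lparr>carrier := a_kernel M N h\<rparr>) M"
    by (auto simp: linear_maps_iff a_kernel_def')
  ultimately show ?thesis
    unfolding short_exact_def
    using assms M.module_axioms N.module_axioms linear by simp
qed

end

section \<open>Diagram chases in short exact sequences\<close>

lemma short_exact_linear_map:
  assumes "short_exact R A B C f g"
  shows "linear_map R A B f" and "linear_map R B C g"
  using assms unfolding short_exact_def linear_map_def linear_map_axioms_def by simp_all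

lemma short_exact_in_image_iff:
  assumes "short_exact R A B C f g"
  shows "x \<in> f ` carrier A \<longleftrightarrow> x \<in> carrier B \<and> g x = \<zero>\<^bsub>C\<^esub>"
  using assms by (auto simp: short_exact_def a_kernel_def')

lemma (in abelian_group) minus_add_cancel:
  assumes "x \<in> carrier G" "y \<in> carrier G"
  shows "x \<ominus> y \<oplus> y = x"
  using assms by (simp add: a_minus_def a_assoc l_neg)

text \<open>The difference of two elements in one fibre of \<open>g\<close> lies in the kernel,
  hence in the image of \<open>f\<close>. This chase serves both the extension lemma and the kernel
  lemma.\<close>

lemma short_exact_fibre:
  assumes ex: "short_exact R A B C f g"
    and x: "x \<in> carrier B" and y: "y \<in> carrier B" and eq: "g x = g y"
  obtains a where "a \<in> carrier A" "x = f a \<oplus>\<^bsub>B\<^esub> y"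
proof -
  interpret g: linear_map R B C g by (rule short_exact_linear_map[OF ex])
  have "g (x \<ominus>\<^bsub>B\<^esub> y) = \<zero>\<^bsub>C\<^esub>"
    using x y eq by (simp add: g.map_diff) (simp add: a_minus_def g.N.M.r_neg)
  then have "x \<ominus>\<^bsub>B\<^esub> y \<in> f ` carrier A"
    unfolding short_exact_in_image_iff[OF ex] using x y by simp
  then obtain a where "a \<in> carrier A" "x \<ominus>\<^bsub>B\<^esub> y = f a" by auto
  then show thesis using that g.M.M.minus_add_cancel[OF x y] by metis
qed


section \<open>\<open>S\<close>-finite modules in exact sequences\<close>

text \<open>Generators of \<open>B\<close> are the images of generators of \<open>A\<close> together
  with lifts of generators of \<open>C\<close>. Multiplying by \<open>t\<close> moves an element
  into the span of the lifts up to an error from \<open>A\<close>, and \<open>s\<close> then moves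
  the error into the span of the images.\<close>

lemma S_finite_extension:
  assumes ex: "short_exact R A B C f g" and S: "submonoid S R"
    and A: "S_finite R S A" and C: "S_finite R S C"
  shows "S_finite R S B"
proof -
  interpret A: module R A using ex by (simp add: short_exact_def)
  interpret B: module R B using ex by (simp add: short_exact_def)
  interpret C: module R C using ex by (simp add: short_exact_def)
  interpret f: linear_map R A B f by (rule short_exact_linear_map[OF ex])
  interpret g: linear_map R B C g by (rule short_exact_linear_map[OF ex])
  interpret S: submonoid S R by (fact S)
  obtain X s where X: "finite X" "X \<subseteq> carrier A" and s: "s \<in> S"
    "\<forall>x\<in>carrier A. s \<odot>\<^bsub>A\<^esub> x \<in> lin_span R A X"
    using A unfolding A.S_finite_iff by blast
  obtain Y t where Y: "finite Y" "Y \<subseteq> carrier C" and t: "t \<in> S"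
    "\<forall>x\<in>carrier C. t \<odot>\<^bsub>C\<^esub> x \<in> lin_span R C Y"
    using C unfolding C.S_finite_iff by blast
  have "Y \<subseteq> g ` carrier B" using Y ex by (simp add: short_exact_def)
  then obtain Z where Z: "finite Z" "Z \<subseteq> carrier B" "Y = g ` Z"
    using finite_subset_image[OF Y(1)] by metis
  define U where "U = f ` X \<union> Z"
  have U: "finite U" "U \<subseteq> carrier B" "f ` X \<subseteq> U" "Z \<subseteq> U" using X Z by (auto simp: U_def)
  have R: "s \<in> carrier R" "t \<in> carrier R" using s t S.subset by auto
  have "(s \<otimes>\<^bsub>R\<^esub> t) \<odot>\<^bsub>B\<^esub> b \<in> lin_span R B U" if b: "b \<in> carrier B" for b
  proof -
    have "g (t \<odot>\<^bsub>B\<^esub> b) \<in> g ` lin_span R B Z"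
      using b t R Z by (simp add: g.map_smult g.image_lin_span)
    then obtain z where z: "z \<in> lin_span R B Z" "g (t \<odot>\<^bsub>B\<^esub> b) = g z" by auto
    have zB: "z \<in> carrier B" using z B.lin_span_closed(1)[OF Z(2)] by blast
    obtain a where a: "a \<in> carrier A" "t \<odot>\<^bsub>B\<^esub> b = f a \<oplus>\<^bsub>B\<^esub> z"
      using short_exact_fibre[OF ex _ zB z(2)] b R by auto
    have "f (s \<odot>\<^bsub>A\<^esub> a) \<in> lin_span R B (f ` X)"
      using a s f.image_lin_span[OF X(2)] by blast
    then have "s \<odot>\<^bsub>B\<^esub> f a \<in> lin_span R B U"
      using hull_mono[OF U(3)] a R by (auto simp: f.map_smult)
    moreover have "s \<odot>\<^bsub>B\<^esub> z \<in> lin_span R B U"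
      using hull_mono[OF U(4)] z R B.lin_span_closed(3)[OF U(2)] by blast
    moreover have "(s \<otimes>\<^bsub>R\<^esub> t) \<odot>\<^bsub>B\<^esub> b = s \<odot>\<^bsub>B\<^esub> f a \<oplus>\<^bsub>B\<^esub> s \<odot>\<^bsub>B\<^esub> z"
      using b a zB R by (simp add: B.smult_assoc1 B.smult_r_distr)
    ultimately show ?thesis
      using B.lin_span_closed(2)[OF U(2)] by simp
  qed
  moreover have "s \<otimes>\<^bsub>R\<^esub> t \<in> S" using s t by simp
  ultimately show ?thesis
    unfolding B.S_finite_iff using U(1,2) by blast
qed

text \<open>The projection onto \<open>N\<close> along \<open>Q\<close> is linear and onto, so this
  is a case of \<open>S_finite_image\<close>.\<close>

lemma (in module) direct_summand_S_finite:
  assumes "S_finite R S M" and "S \<subseteq> carrier R" and "direct_summand N R M"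
  shows "S_finite R S (M\<lparr>carrier := N\<rparr>)"
proof -
  obtain Q where N: "submodule N R M" and Q: "submodule Q R M"
    and sum: "N <+>\<^bsub>M\<^esub> Q = carrier M" and int: "N \<inter> Q = {\<zero>\<^bsub>M\<^esub>}"
    using assms(3) by (auto simp: direct_summand_def)
  have NM: "N \<subseteq> carrier M" and QM: "Q \<subseteq> carrier M" using N Q by (auto simp: submodule_iff)
  have decomp: "\<exists>n\<in>N. \<exists>q\<in>Q. x = n \<oplus>\<^bsub>M\<^esub> q" if "x \<in> carrier M" for x
    using that unfolding sum[symmetric] set_add_def' by auto
  then obtain p r where pr: "\<And>x. x \<in> carrier M \<Longrightarrow> p x \<in> N \<and> r x \<in> Q \<and> x = p x \<oplus>\<^bsub>M\<^esub> r x"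
    by metis
  \<comment> \<open>Two decompositions differ by an element of \<open>N\<close> that also lies in
    \<open>Q\<close>, hence by zero. Linearity of \<open>p\<close> is then read off from sums and
    multiples of decompositions.\<close>
  have unique: "p x = n" if "n \<in> N" "q \<in> Q" "x = n \<oplus>\<^bsub>M\<^esub> q" for x n q
  proof -
    have x: "x \<in> carrier M" using that NM QM by auto
    have c: "n \<in> carrier M" "q \<in> carrier M" "p x \<in> carrier M" "r x \<in> carrier M"
      using that pr[OF x] NM QM by auto
    have "p x \<ominus>\<^bsub>M\<^esub> n = q \<ominus>\<^bsub>M\<^esub> r x"
    proof -
      have "p x \<oplus>\<^bsub>M\<^esub> r x = n \<oplus>\<^bsub>M\<^esub> q" using pr[OF x] that by simp
      then have "p x = (n \<oplus>\<^bsub>M\<^esub> q) \<ominus>\<^bsub>M\<^esub> r x"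
        using c by (metis M.add.inv_solve_right M.a_closed a_minus_def)
      then have "p x = (q \<ominus>\<^bsub>M\<^esub> r x) \<oplus>\<^bsub>M\<^esub> n" using c by (simp add: a_minus_def M.a_ac)
      then show ?thesis
        using c by (simp add: a_minus_def M.a_assoc M.r_neg)
    qed
    moreover have "p x \<ominus>\<^bsub>M\<^esub> n \<in> N" "q \<ominus>\<^bsub>M\<^esub> r x \<in> Q"
      using submoduleE(3,5)[OF N] submoduleE(3,5)[OF Q] pr[OF x] that by (simp_all add: a_minus_def)
    ultimately have "p x \<ominus>\<^bsub>M\<^esub> n = \<zero>\<^bsub>M\<^esub>" using int by auto
    then show ?thesis using c M.minus_add_cancel[of "p x" n] by simp
  qed
  have zero: "\<zero>\<^bsub>M\<^esub> \<in> Q" using Q by (simp add: submodule_iff)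
  have "p (x \<oplus>\<^bsub>M\<^esub> y) = p x \<oplus>\<^bsub>M\<^esub> p y" if "x \<in> carrier M" "y \<in> carrier M" for x y
  proof (rule unique)
    show "x \<oplus>\<^bsub>M\<^esub> y = (p x \<oplus>\<^bsub>M\<^esub> p y) \<oplus>\<^bsub>M\<^esub> (r x \<oplus>\<^bsub>M\<^esub> r y)"
    proof -
      have "p x \<in> carrier M" "p y \<in> carrier M" "r x \<in> carrier M" "r y \<in> carrier M"
        using pr that NM QM by blast+
      then have "(p x \<oplus>\<^bsub>M\<^esub> p y) \<oplus>\<^bsub>M\<^esub> (r x \<oplus>\<^bsub>M\<^esub> r y) = (p x \<oplus>\<^bsub>M\<^esub> r x) \<oplus>\<^bsub>M\<^esub> (p y \<oplus>\<^bsub>M\<^esub> r y)"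
        by (simp add: M.a_ac)
      then show ?thesis using pr that by simp
    qed
  qed (use pr that submoduleE(5)[OF N] submoduleE(5)[OF Q] in auto)
  moreover have "p (a \<odot>\<^bsub>M\<^esub> x) = a \<odot>\<^bsub>M\<^esub> p x" if "a \<in> carrier R" "x \<in> carrier M" for a x
  proof (rule unique)
    have "p x \<in> carrier M" "r x \<in> carrier M" using pr that NM QM by blast+
    then have "a \<odot>\<^bsub>M\<^esub> (p x \<oplus>\<^bsub>M\<^esub> r x) = a \<odot>\<^bsub>M\<^esub> p x \<oplus>\<^bsub>M\<^esub> a \<odot>\<^bsub>M\<^esub> r x"
      using that by (simp add: smult_r_distr)
    then show "a \<odot>\<^bsub>M\<^esub> x = a \<odot>\<^bsub>M\<^esub> p x \<oplus>\<^bsub>M\<^esub> a \<odot>\<^bsub>M\<^esub> r x" using pr that by simp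
  qed (use pr that submoduleE(4)[OF N] submoduleE(4)[OF Q] in auto)
  ultimately have lin: "p \<in> linear_maps R M (M\<lparr>carrier := N\<rparr>)"
    using pr by (simp add: linear_maps_iff)
  interpret p: linear_map R M "M\<lparr>carrier := N\<rparr>" p
    by (intro linear_map.intro linear_map_axioms.intro lin module_axioms
        submodule.submodule_is_module[OF N])
  \<comment> \<open>An element \<open>n\<close> of \<open>N\<close> decomposes as \<open>n\<close>
    plus zero, so \<open>p\<close> fixes \<open>N\<close> pointwise and is onto.\<close>
  have "p n = n" if "n \<in> N" for n using unique[of n "\<zero>\<^bsub>M\<^esub>"] that zero NM by auto
  then have "p ` carrier M = N" using pr NM by (auto simp: image_iff) (metis subsetD)
  then show ?thesis using p.S_finite_image assms by simp
qed


section \<open>Kernels onto \<open>S\<close>-finitely presented modules\<close>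

text \<open>Summing over the support allows infinite bases. The vectors \<open>v b\<close> are kept
  apart from their indices \<open>b\<close>, so that a linear map can act on the vectors while the
  coefficients keep their index set, even if the map identifies some vectors.\<close>

definition lin_comb where
  "lin_comb R M v B c = (\<Oplus>\<^bsub>M\<^esub>b\<in>{b \<in> B. c b \<noteq> \<zero>\<^bsub>R\<^esub>}. c b \<odot>\<^bsub>M\<^esub> v b)"

context module
begin

lemma lin_comb_closed:
  assumes "v \<in> B \<rightarrow> carrier M" and "c \<in> B \<rightarrow> carrier R"
  shows "lin_comb R M v B c \<in> carrier M"
  unfolding lin_comb_def using assms by (intro M.finsum_closed) auto

text \<open>Supports change under addition and scaling. Sums become comparable once they run over a
  common finite set, where the extra terms vanish.\<close>

lemma lin_comb_superset:
  assumes "v \<in> B \<rightarrow> carrier M" and "c \<in> B \<rightarrow> carrier R"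
    and "finite T" "T \<subseteq> B" "{b \<in> B. c b \<noteq> \<zero>} \<subseteq> T"
  shows "lin_comb R M v B c = (\<Oplus>\<^bsub>M\<^esub>b\<in>T. c b \<odot>\<^bsub>M\<^esub> v b)"
  unfolding lin_comb_def
  using assms by (intro M.add.finprod_mono_neutral_cong_left) (auto simp: Pi_iff)

lemma lin_comb_add:
  assumes v: "v \<in> B \<rightarrow> carrier M" and c: "c \<in> B \<rightarrow> carrier R" "finite {b \<in> B. c b \<noteq> \<zero>}"
    and d: "d \<in> B \<rightarrow> carrier R" "finite {b \<in> B. d b \<noteq> \<zero>}"
  shows "lin_comb R M v B (\<lambda>b\<in>B. c b \<oplus> d b) = lin_comb R M v B c \<oplus>\<^bsub>M\<^esub> lin_comb R M v B d"
proof -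
  \<comment> \<open>Cancellation can make the support of the sum smaller than this union, so all
    three sums are taken over the union.\<close>
  define T where "T = {b \<in> B. c b \<noteq> \<zero>} \<union> {b \<in> B. d b \<noteq> \<zero>}"
  have T: "finite T" "T \<subseteq> B" using c d by (auto simp: T_def)
  have vT: "b \<in> T \<Longrightarrow> v b \<in> carrier M" "b \<in> T \<Longrightarrow> c b \<in> carrier R" "b \<in> T \<Longrightarrow> d b \<in> carrier R" for b
    using v c d T by auto
  have "lin_comb R M v B (\<lambda>b\<in>B. c b \<oplus> d b) = (\<Oplus>\<^bsub>M\<^esub>b\<in>T. (\<lambda>b\<in>B. c b \<oplus> d b) b \<odot>\<^bsub>M\<^esub> v b)"
    using v c d T by (intro lin_comb_superset) (auto simp: T_def)
  also have "\<dots> = (\<Oplus>\<^bsub>M\<^esub>b\<in>T. c b \<odot>\<^bsub>M\<^esub> v b \<oplus>\<^bsub>M\<^esub> d b \<odot>\<^bsub>M\<^esub> v b)"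
    using vT T by (intro M.finsum_cong') (auto simp: smult_l_distr subset_iff)
  also have "\<dots> = (\<Oplus>\<^bsub>M\<^esub>b\<in>T. c b \<odot>\<^bsub>M\<^esub> v b) \<oplus>\<^bsub>M\<^esub> (\<Oplus>\<^bsub>M\<^esub>b\<in>T. d b \<odot>\<^bsub>M\<^esub> v b)"
    using vT by (intro M.finsum_addf) auto
  also have "(\<Oplus>\<^bsub>M\<^esub>b\<in>T. c b \<odot>\<^bsub>M\<^esub> v b) = lin_comb R M v B c"
    using v c d T by (intro lin_comb_superset[symmetric]) (auto simp: T_def)
  also have "(\<Oplus>\<^bsub>M\<^esub>b\<in>T. d b \<odot>\<^bsub>M\<^esub> v b) = lin_comb R M v B d"
    using v c d T by (intro lin_comb_superset[symmetric]) (auto simp: T_def)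
  finally show ?thesis .
qed

lemma lin_comb_smult:
  assumes v: "v \<in> B \<rightarrow> carrier M" and c: "c \<in> B \<rightarrow> carrier R" "finite {b \<in> B. c b \<noteq> \<zero>}"
    and a: "a \<in> carrier R"
  shows "lin_comb R M v B (\<lambda>b\<in>B. a \<otimes> c b) = a \<odot>\<^bsub>M\<^esub> lin_comb R M v B c"
proof -
  let ?T = "{b \<in> B. c b \<noteq> \<zero>}"
  have vT: "b \<in> ?T \<Longrightarrow> v b \<in> carrier M" "b \<in> ?T \<Longrightarrow> c b \<in> carrier R" for b
    using v c by auto
  have "lin_comb R M v B (\<lambda>b\<in>B. a \<otimes> c b) = (\<Oplus>\<^bsub>M\<^esub>b\<in>?T. (\<lambda>b\<in>B. a \<otimes> c b) b \<odot>\<^bsub>M\<^esub> v b)"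
    using v c a by (intro lin_comb_superset) auto
  also have "\<dots> = (\<Oplus>\<^bsub>M\<^esub>b\<in>?T. a \<odot>\<^bsub>M\<^esub> (c b \<odot>\<^bsub>M\<^esub> v b))"
    using vT a by (intro M.finsum_cong') (auto simp: smult_assoc1)
  also have "\<dots> = a \<odot>\<^bsub>M\<^esub> lin_comb R M v B c"
    unfolding lin_comb_def using vT a c by (intro finsum_smult_ldistr[symmetric]) auto
  finally show ?thesis .
qed

end

lemma (in linear_map) map_lin_comb:
  assumes "v \<in> B \<rightarrow> carrier M" and "c \<in> B \<rightarrow> carrier R"
  shows "h (lin_comb R M v B c) = lin_comb R N (\<lambda>b. h (v b)) B c"
proof -
  have "h (lin_comb R M v B c) = (\<Oplus>\<^bsub>N\<^esub>b\<in>{b \<in> B. c b \<noteq> \<zero>}. h (c b \<odot>\<^bsub>M\<^esub> v b))"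
    unfolding lin_comb_def using assms by (intro map_finsum) auto
  also have "\<dots> = lin_comb R N (\<lambda>b. h (v b)) B c"
    unfolding lin_comb_def using assms
    by (intro N.M.finsum_cong') (auto simp: map_smult Pi_iff)
  finally show ?thesis .
qed

lemma free_module_iff:
  "free_module R M \<longleftrightarrow>
     (\<exists>E \<subseteq> carrier M. \<forall>x\<in>carrier M. \<exists>!c. c \<in> E \<rightarrow>\<^sub>E carrier R \<and>
        finite {b \<in> E. c b \<noteq> \<zero>\<^bsub>R\<^esub>} \<and> x = lin_comb R M (\<lambda>b. b) E c)"
  by (simp only: free_module_def lin_comb_def)

text \<open>Choosing preimages under \<open>g\<close> of the values \<open>p b\<close> at basis
  elements and extending by coordinates gives the lift; coordinates are linear because they are
  unique.\<close>

lemma free_module_projective: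
  assumes free: "free_module R F" and "linear_map R F C p" and "linear_map R B C g"
    and surj: "g ` carrier B = carrier C"
  obtains q where "linear_map R F B q" "\<And>x. x \<in> carrier F \<Longrightarrow> g (q x) = p x"
proof -
  interpret p: linear_map R F C p by fact
  interpret g: linear_map R B C g by fact
  interpret B: module R B by unfold_locales
  obtain E where E: "E \<subseteq> carrier F"
    and basis: "\<forall>x\<in>carrier F. \<exists>!c. c \<in> E \<rightarrow>\<^sub>E carrier R \<and>
      finite {b \<in> E. c b \<noteq> \<zero>\<^bsub>R\<^esub>} \<and> x = lin_comb R F (\<lambda>b. b) E c"
    using free unfolding free_module_iff by (elim exE conjE) (rule that)
  define coord where "coord x = (THE c. c \<in> E \<rightarrow>\<^sub>E carrier R \<and>
      finite {b \<in> E. c b \<noteq> \<zero>\<^bsub>R\<^esub>} \<and> x = lin_comb R F (\<lambda>b. b) E c)" for x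
  have coord: "coord x \<in> E \<rightarrow>\<^sub>E carrier R" "finite {b \<in> E. coord x b \<noteq> \<zero>\<^bsub>R\<^esub>}"
      "x = lin_comb R F (\<lambda>b. b) E (coord x)" if "x \<in> carrier F" for x
    using theI'[OF basis[rule_format, OF that]] unfolding coord_def by blast+
  have coordI: "coord x = c" if "x \<in> carrier F" "c \<in> E \<rightarrow>\<^sub>E carrier R" "finite {b \<in> E. c b \<noteq> \<zero>\<^bsub>R\<^esub>}"
      "x = lin_comb R F (\<lambda>b. b) E c" for x c
    using that unfolding coord_def by (intro the1_equality basis[rule_format]) auto
  have coordR: "coord x \<in> E \<rightarrow> carrier R" if "x \<in> carrier F" for x
    using coord(1)[OF that] by (simp add: PiE_def)
  have E': "(\<lambda>b. b) \<in> E \<rightarrow> carrier F" using E by auto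
  \<comment> \<open>The pointwise sum represents the sum of the two elements, and uniqueness
    identifies it with the coordinates. Restricting it to \<open>E\<close> makes it extensional, as
    uniqueness requires.\<close>
  have coord_add: "coord (x \<oplus>\<^bsub>F\<^esub> y) = (\<lambda>b\<in>E. coord x b \<oplus>\<^bsub>R\<^esub> coord y b)"
    if x: "x \<in> carrier F" and y: "y \<in> carrier F" for x y
  proof (rule coordI)
    show "finite {b \<in> E. (\<lambda>b\<in>E. coord x b \<oplus>\<^bsub>R\<^esub> coord y b) b \<noteq> \<zero>\<^bsub>R\<^esub>}"
      using coord(2)[OF x] coord(2)[OF y]
      by (rule finite_subset[rotated, OF finite_UnI]) auto
    show "x \<oplus>\<^bsub>F\<^esub> y = lin_comb R F (\<lambda>b. b) E (\<lambda>b\<in>E. coord x b \<oplus>\<^bsub>R\<^esub> coord y b)"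
      using p.M.lin_comb_add[OF E' coordR[OF x] coord(2)[OF x] coordR[OF y] coord(2)[OF y]]
        coord(3)[OF x] coord(3)[OF y] by simp
  qed (use x y coordR[OF x] coordR[OF y] in auto)
  have coord_smult: "coord (a \<odot>\<^bsub>F\<^esub> x) = (\<lambda>b\<in>E. a \<otimes>\<^bsub>R\<^esub> coord x b)"
    if a: "a \<in> carrier R" and x: "x \<in> carrier F" for a x
  proof (rule coordI)
    show "finite {b \<in> E. (\<lambda>b\<in>E. a \<otimes>\<^bsub>R\<^esub> coord x b) b \<noteq> \<zero>\<^bsub>R\<^esub>}"
      using a by (intro finite_subset[OF _ coord(2)[OF x]]) auto
    show "a \<odot>\<^bsub>F\<^esub> x = lin_comb R F (\<lambda>b. b) E (\<lambda>b\<in>E. a \<otimes>\<^bsub>R\<^esub> coord x b)"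
      using p.M.lin_comb_smult[OF E' coordR[OF x] coord(2)[OF x] a] coord(3)[OF x] by simp
  qed (use a x coordR[OF x] in auto)
  have "\<forall>b\<in>E. \<exists>y\<in>carrier B. g y = p b"
    using E surj by (metis imageE p.map_closed subsetD)
  then obtain l where l: "\<And>b. b \<in> E \<Longrightarrow> l b \<in> carrier B" "\<And>b. b \<in> E \<Longrightarrow> g (l b) = p b"
    by metis
  have lB: "l \<in> E \<rightarrow> carrier B" using l by auto
  define q where "q x = lin_comb R B l E (coord x)" for x
  have "q \<in> linear_maps R F B"
    unfolding linear_maps_iff q_def
    using g.M.lin_comb_closed[OF lB coordR] g.M.lin_comb_add[OF lB coordR coord(2) coordR coord(2)]
      g.M.lin_comb_smult[OF lB coordR coord(2)]
    by (simp add: coord_add coord_smult)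
  then have "linear_map R F B q"
    by (intro linear_map.intro linear_map_axioms.intro p.M.module_axioms g.M.module_axioms)
  moreover have "g (q x) = p x" if x: "x \<in> carrier F" for x
  proof -
    have "g (q x) = lin_comb R C (\<lambda>b. g (l b)) E (coord x)"
      unfolding q_def by (rule g.map_lin_comb[OF lB coordR[OF x]])
    also have "\<dots> = lin_comb R C p E (coord x)"
      unfolding lin_comb_def using l E coordR[OF x]
      by (intro p.N.M.finsum_cong') (auto simp: Pi_iff subset_iff)
    also have "\<dots> = p x"
      using p.map_lin_comb[OF E' coordR[OF x]] coord(3)[OF x] by simp
    finally show ?thesis .
  qed
  ultimately show thesis using that by blast
qed

text \<open>Modulo \<open>q F\<close>, every element of \<open>B\<close> comes from
  \<open>A\<close>, and the part of \<open>q F\<close> inside the image of \<open>A\<close> comes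
  from \<open>K\<close>. So generators of \<open>B\<close> control \<open>A\<close> up to
  \<open>q K\<close>, and generators of \<open>K\<close> control the rest.\<close>

lemma S_finite_kernel:
  fixes R :: "('a, 'r) ring_scheme"
  assumes ex: "short_exact R A B C f g" and S: "submonoid S R"
    and B: "S_finite R S B" and C: "S_finitely_presented R S C"
  shows "S_finite R S A"
proof -
  interpret A: module R A using ex by (simp add: short_exact_def)
  interpret B: module R B using ex by (simp add: short_exact_def)
  interpret f: linear_map R A B f by (rule short_exact_linear_map[OF ex])
  interpret g: linear_map R B C g by (rule short_exact_linear_map[OF ex])
  interpret S: submonoid S R by (fact S)
  have g_surj: "g ` carrier B = carrier C" and f_inj: "inj_on f (carrier A)"
    using ex by (simp_all add: short_exact_def)
  obtain K F :: "('a, nat \<Rightarrow> 'a) module" and i p where pres: "short_exact R K F C i p"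
    and K: "S_finite R S K" and free: "free_module R F"
    using C unfolding S_finitely_presented_def by blast
  interpret K: module R K using pres by (simp add: short_exact_def)
  interpret i: linear_map R K F i by (rule short_exact_linear_map[OF pres])
  interpret p: linear_map R F C p by (rule short_exact_linear_map[OF pres])
  have p_surj: "p ` carrier F = carrier C" using pres by (simp add: short_exact_def)
  obtain q where "linear_map R F B q" and gq: "\<And>x. x \<in> carrier F \<Longrightarrow> g (q x) = p x"
    using free_module_projective[OF free p.linear_map_axioms g.linear_map_axioms g_surj] by blast
  then interpret q: linear_map R F B q by simp
  \<comment> \<open>Since \<open>g (q (i k)) = p (i k) = 0\<close>, the map \<open>q\<close> carries
    \<open>K\<close> into the image of \<open>A\<close>; \<open>w\<close> is that restriction read
    in \<open>A\<close>.\<close>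
  have "\<exists>a\<in>carrier A. f a = q (i k)" if "k \<in> carrier K" for k
  proof -
    have "p (i k) = \<zero>\<^bsub>C\<^esub>" using that short_exact_in_image_iff[OF pres] by blast
    then have "q (i k) \<in> f ` carrier A"
      unfolding short_exact_in_image_iff[OF ex] using that gq[of "i k"] by simp
    then show ?thesis by auto
  qed
  then obtain w where w: "\<And>k. k \<in> carrier K \<Longrightarrow> w k \<in> carrier A"
    "\<And>k. k \<in> carrier K \<Longrightarrow> f (w k) = q (i k)" by metis
  \<comment> \<open>Since \<open>p\<close> is onto, \<open>g b\<close> equals \<open>g (q y)\<close>
    for some \<open>y\<close>, and \<open>b\<close> and \<open>q y\<close> lie in one fibre of
    \<open>g\<close>.\<close>
  have "\<exists>a y. a \<in> carrier A \<and> y \<in> carrier F \<and> b = f a \<oplus>\<^bsub>B\<^esub> q y" if "b \<in> carrier B" for b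
  proof -
    have "g b \<in> p ` carrier F" using that p_surj by simp
    then obtain y where y: "y \<in> carrier F" "g b = g (q y)" using gq by auto
    then show ?thesis using short_exact_fibre[OF ex that _ y(2)] by (metis q.map_closed)
  qed
  then obtain z y where zy: "\<And>b. b \<in> carrier B \<Longrightarrow> z b \<in> carrier A"
    "\<And>b. b \<in> carrier B \<Longrightarrow> y b \<in> carrier F" "\<And>b. b \<in> carrier B \<Longrightarrow> b = f (z b) \<oplus>\<^bsub>B\<^esub> q (y b)"
    by metis
  obtain X s where X: "finite X" "X \<subseteq> carrier B" and s: "s \<in> S"
    "\<forall>x\<in>carrier B. s \<odot>\<^bsub>B\<^esub> x \<in> lin_span R B X"
    using B unfolding B.S_finite_iff by blast
  obtain Y t where Y: "finite Y" "Y \<subseteq> carrier K" and t: "t \<in> S"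
    "\<forall>x\<in>carrier K. t \<odot>\<^bsub>K\<^esub> x \<in> lin_span R K Y"
    using K unfolding K.S_finite_iff by blast
  have R: "s \<in> carrier R" "t \<in> carrier R" using s t S.subset by auto
  \<comment> \<open>\<open>A\<close> is \<open>S\<close>-generated by the generators of \<open>B\<close> corrected by elements of \<open>q ` F\<close>, together with the
    generators of \<open>K\<close>, which \<open>q\<close> maps into the image of \<open>A\<close>.\<close>
  define Z where "Z = z ` X \<union> w ` Y"
  have Z: "finite Z" "Z \<subseteq> carrier A" "z ` X \<subseteq> Z" "w ` Y \<subseteq> Z"
    using X Y zy(1) w(1) by (auto simp: Z_def)
  have zX: "z ` X \<subseteq> carrier A" using zy(1) X by auto
  \<comment> \<open>The map \<open>z\<close> is a mere choice and need not be linear, so the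
    decomposition is carried from \<open>X\<close> to its span by checking that the elements with
    such a decomposition form a submodule.\<close>
  have span_X: "\<exists>a\<in>lin_span R A (z ` X). \<exists>u\<in>carrier F. b = f a \<oplus>\<^bsub>B\<^esub> q u" if "b \<in> lin_span R B X" for b
  proof -
    let ?H = "{b \<in> carrier B. \<exists>a\<in>lin_span R A (z ` X). \<exists>u\<in>carrier F. b = f a \<oplus>\<^bsub>B\<^esub> q u}"
    note sp = A.lin_span_closed[OF zX] A.submodule_lin_span[OF zX]
    have "submodule ?H R B"
    proof (subst B.submodule_iff, intro conjI ballI)
      have "\<zero>\<^bsub>A\<^esub> \<in> lin_span R A (z ` X)" using sp(4) A.submodule_iff by blast
      then show "\<zero>\<^bsub>B\<^esub> \<in> ?H" by (auto intro!: bexI[of _ "\<zero>\<^bsub>A\<^esub>"] bexI[of _ "\<zero>\<^bsub>F\<^esub>"])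
    next
      fix b b' assume b: "b \<in> ?H" and b': "b' \<in> ?H"
      obtain a u where a: "a \<in> lin_span R A (z ` X)" "u \<in> carrier F" "b = f a \<oplus>\<^bsub>B\<^esub> q u" using b by blast
      obtain a' u' where a': "a' \<in> lin_span R A (z ` X)" "u' \<in> carrier F" "b' = f a' \<oplus>\<^bsub>B\<^esub> q u'" using b' by blast
      have aA: "a \<in> carrier A" "a' \<in> carrier A" using a a' sp(1) by blast+
      then have "b \<oplus>\<^bsub>B\<^esub> b' = f (a \<oplus>\<^bsub>A\<^esub> a') \<oplus>\<^bsub>B\<^esub> q (u \<oplus>\<^bsub>F\<^esub> u')"
        using a(2,3) a'(2,3) by (simp add: f.map_add q.map_add B.M.a_ac)
      moreover have "a \<oplus>\<^bsub>A\<^esub> a' \<in> lin_span R A (z ` X)" using a a' sp by blast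
      moreover have "b \<oplus>\<^bsub>B\<^esub> b' \<in> carrier B" "u \<oplus>\<^bsub>F\<^esub> u' \<in> carrier F" using b b' a a' by auto
      ultimately show "b \<oplus>\<^bsub>B\<^esub> b' \<in> ?H" by blast
    next
      fix c b assume c: "c \<in> carrier R" and b: "b \<in> ?H"
      obtain a u where a: "a \<in> lin_span R A (z ` X)" "u \<in> carrier F" "b = f a \<oplus>\<^bsub>B\<^esub> q u" using b by blast
      have aA: "a \<in> carrier A" using a sp(1) by blast+
      then have "c \<odot>\<^bsub>B\<^esub> b = f (c \<odot>\<^bsub>A\<^esub> a) \<oplus>\<^bsub>B\<^esub> q (c \<odot>\<^bsub>F\<^esub> u)"
        using a(2,3) c by (simp add: f.map_smult q.map_smult B.smult_r_distr)
      moreover have "c \<odot>\<^bsub>A\<^esub> a \<in> lin_span R A (z ` X)" using a c sp by blast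
      moreover have "c \<odot>\<^bsub>B\<^esub> b \<in> carrier B" "c \<odot>\<^bsub>F\<^esub> u \<in> carrier F" using b c a by auto
      ultimately show "c \<odot>\<^bsub>B\<^esub> b \<in> ?H" by blast
    qed auto
    moreover have "X \<subseteq> ?H"
      using X zy hull_inc[of _ "z ` X" "\<lambda>N. submodule N R A"] by blast
    ultimately have "lin_span R B X \<subseteq> ?H" by (intro hull_minimal)
    then show ?thesis using that by blast
  qed
  \<comment> \<open>The factor \<open>s\<close> moves \<open>f m\<close> into the span of
    \<open>X\<close>; what is left over comes from \<open>K\<close>, where \<open>t\<close> does the
    same for the span of \<open>Y\<close>.\<close>
  have "(t \<otimes>\<^bsub>R\<^esub> s) \<odot>\<^bsub>A\<^esub> m \<in> lin_span R A Z" if m: "m \<in> carrier A" for m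
  proof -
    have "s \<odot>\<^bsub>B\<^esub> f m \<in> lin_span R B X" using s m by simp
    then obtain a u where a: "a \<in> lin_span R A (z ` X)" and u: "u \<in> carrier F"
      and eq: "s \<odot>\<^bsub>B\<^esub> f m = f a \<oplus>\<^bsub>B\<^esub> q u" using span_X by blast
    have aA: "a \<in> carrier A" using a A.lin_span_closed(1)[OF zX] by blast
    have gf: "g (f x) = \<zero>\<^bsub>C\<^esub>" if "x \<in> carrier A" for x
      using that short_exact_in_image_iff[OF ex, of "f x"] by blast
    \<comment> \<open>Applying \<open>g\<close> kills the parts coming from \<open>A\<close>. This
      leaves \<open>p u = 0\<close>, which puts \<open>u\<close> in the image of
      \<open>K\<close>.\<close>
    have "g (f (s \<odot>\<^bsub>A\<^esub> m)) = g (f a \<oplus>\<^bsub>B\<^esub> q u)" using eq m R by (simp add: f.map_smult)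
    then have "p u = \<zero>\<^bsub>C\<^esub>" using gf m aA u R gq[OF u] by (simp add: g.map_add)
    then obtain k where k: "k \<in> carrier K" "u = i k"
      using u short_exact_in_image_iff[OF pres, of u] by blast
    \<comment> \<open>The span is pushed through \<open>i\<close> and \<open>q\<close> down to the
      generators, where \<open>q i\<close> and \<open>f w\<close> agree, and then pulled back
      through \<open>f\<close>.\<close>
    have "q (i (t \<odot>\<^bsub>K\<^esub> k)) \<in> f ` lin_span R A (w ` Y)"
    proof -
      have wY: "w ` Y \<subseteq> carrier A" and iY: "i ` Y \<subseteq> carrier F" using w(1) Y by auto
      have "q (i (t \<odot>\<^bsub>K\<^esub> k)) \<in> q ` i ` lin_span R K Y" using t k by blast
      also have "\<dots> = lin_span R B (q ` i ` Y)"
        by (simp only: i.image_lin_span[OF Y(2)] q.image_lin_span[OF iY])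
      also have "q ` i ` Y = f ` w ` Y" using w(2) Y(2) by (force simp: image_image)
      also have "lin_span R B (f ` w ` Y) = f ` lin_span R A (w ` Y)"
        by (simp only: f.image_lin_span[OF wY])
      finally show ?thesis .
    qed
    then obtain v where v: "v \<in> lin_span R A (w ` Y)" "q (i (t \<odot>\<^bsub>K\<^esub> k)) = f v" by auto
    have vZ: "v \<in> lin_span R A Z" using v hull_mono[OF Z(4)] by blast
    have taZ: "t \<odot>\<^bsub>A\<^esub> a \<in> lin_span R A Z"
      using a hull_mono[OF Z(3)] R A.lin_span_closed(3)[OF Z(2)] by blast
    have vA: "v \<in> carrier A" using vZ A.lin_span_closed(1)[OF Z(2)] by blast
    have "f ((t \<otimes>\<^bsub>R\<^esub> s) \<odot>\<^bsub>A\<^esub> m) = t \<odot>\<^bsub>B\<^esub> (s \<odot>\<^bsub>B\<^esub> f m)"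
      using m R by (simp add: A.smult_assoc1 f.map_smult)
    also have "\<dots> = f (t \<odot>\<^bsub>A\<^esub> a) \<oplus>\<^bsub>B\<^esub> q (t \<odot>\<^bsub>F\<^esub> u)"
      unfolding eq using aA u R by (simp add: B.smult_r_distr f.map_smult q.map_smult)
    also have "q (t \<odot>\<^bsub>F\<^esub> u) = f v" using v k R by (simp add: i.map_smult)
    also have "f (t \<odot>\<^bsub>A\<^esub> a) \<oplus>\<^bsub>B\<^esub> f v = f (t \<odot>\<^bsub>A\<^esub> a \<oplus>\<^bsub>A\<^esub> v)"
      using aA vA R by (simp add: f.map_add)
    finally have "(t \<otimes>\<^bsub>R\<^esub> s) \<odot>\<^bsub>A\<^esub> m = t \<odot>\<^bsub>A\<^esub> a \<oplus>\<^bsub>A\<^esub> v"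
      using m R aA vA by (intro inj_onD[OF f_inj]) auto
    then show ?thesis using A.lin_span_closed(2)[OF Z(2) taZ vZ] by simp
  qed
  moreover have "t \<otimes>\<^bsub>R\<^esub> s \<in> S" using s t by simp
  ultimately show ?thesis
    unfolding A.S_finite_iff using Z(1,2) by blast
qed

section \<open>\<open>S\<close>-finite presentations\<close>

lemma linear_map_compose:
  assumes "linear_map R A B f" and "linear_map R B C g"
  shows "linear_map R A C (\<lambda>x. g (f x))"
proof -
  interpret f: linear_map R A B f by fact
  interpret g: linear_map R B C g by fact
  show ?thesis
    by (intro linear_map.intro linear_map_axioms.intro f.M.module_axioms g.N.module_axioms)
      (simp add: linear_maps_iff f.map_add g.map_add f.map_smult g.map_smult)
qed

text \<open>\<open>p\<close> maps the kernel of \<open>g p\<close> onto the kernel of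
  \<open>g\<close>, which is a copy of \<open>A\<close> through the injective \<open>f\<close>; the
  part killed is the kernel of \<open>p\<close>, that is, \<open>K\<close>.\<close>

lemma short_exact_kernel_compose:
  assumes ex: "short_exact R A B C f g" and pres: "short_exact R K F B i p"
  shows "short_exact R K (F\<lparr>carrier := a_kernel F C (\<lambda>x. g (p x))\<rparr>) A i
           (\<lambda>x. inv_into (carrier A) f (p x))"
proof -
  interpret A: module R A using ex by (simp add: short_exact_def)
  interpret F: module R F using pres by (simp add: short_exact_def)
  interpret f: linear_map R A B f by (rule short_exact_linear_map[OF ex])
  interpret g: linear_map R B C g by (rule short_exact_linear_map[OF ex])
  interpret i: linear_map R K F i by (rule short_exact_linear_map[OF pres])
  interpret p: linear_map R F B p by (rule short_exact_linear_map[OF pres])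
  interpret gp: linear_map R F C "\<lambda>x. g (p x)"
    by (rule linear_map_compose[OF p.linear_map_axioms g.linear_map_axioms])
  define L where "L = F\<lparr>carrier := a_kernel F C (\<lambda>x. g (p x))\<rparr>"
  have L: "carrier L = {x \<in> carrier F. g (p x) = \<zero>\<^bsub>C\<^esub>}" "add L = add F" "smult L = smult F" "zero L = zero F"
    by (simp_all add: L_def a_kernel_def')
  have L_module: "module R L"
    unfolding L_def using gp.submodule_kernel submodule.submodule_is_module F.module_axioms by blast
  have f_inj: "inj_on f (carrier A)" and p_surj: "p ` carrier F = carrier B"
    and i_inj: "inj_on i (carrier K)" and K: "module R K"
    using ex pres by (simp_all add: short_exact_def)
  have im_i: "x \<in> i ` carrier K \<longleftrightarrow> x \<in> carrier F \<and> p x = \<zero>\<^bsub>B\<^esub>" for x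
    by (rule short_exact_in_image_iff[OF pres])
  define h where "h x = inv_into (carrier A) f (p x)" for x
  have h: "h x \<in> carrier A" "f (h x) = p x" if "x \<in> carrier L" for x
  proof -
    have "p x \<in> f ` carrier A"
      using that unfolding short_exact_in_image_iff[OF ex] by (simp add: L)
    then show "h x \<in> carrier A" "f (h x) = p x"
      unfolding h_def by (rule inv_into_into, rule f_inv_into_f)
  qed
  \<comment> \<open>Injectivity of \<open>f\<close> turns an equation for \<open>h\<close> into one
    between values of the linear maps \<open>p\<close> and \<open>f\<close>. Linearity, kernel and
    image of \<open>h\<close> all go through this.\<close>
  have hI: "h x = a" if "a \<in> carrier A" "p x = f a" for x a
    using that f_inj by (simp add: h_def)
  have LF: "x \<in> carrier F" if "x \<in> carrier L" for x using that by (simp add: L)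
  have pi: "p (i k) = \<zero>\<^bsub>B\<^esub>" if "k \<in> carrier K" for k using that im_i by blast
  have "i \<in> linear_maps R K L"
    using pi by (auto simp: linear_maps_iff L i.map_add i.map_smult)
  moreover have "h \<in> linear_maps R L A"
    unfolding linear_maps_iff
  proof (intro conjI ballI)
    fix x y assume "x \<in> carrier L" "y \<in> carrier L"
    then show "h (x \<oplus>\<^bsub>L\<^esub> y) = h x \<oplus>\<^bsub>A\<^esub> h y"
      using h LF by (intro hI) (simp_all add: L(2-) p.map_add f.map_add)
  next
    fix a x assume "a \<in> carrier R" "x \<in> carrier L"
    then show "h (a \<odot>\<^bsub>L\<^esub> x) = a \<odot>\<^bsub>A\<^esub> h x"
      using h LF by (intro hI) (simp_all add: L(2-) p.map_smult f.map_smult)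
  qed (rule h)
  moreover have "i ` carrier K = a_kernel L A h"
  proof -
    have "p x = \<zero>\<^bsub>B\<^esub> \<longleftrightarrow> h x = \<zero>\<^bsub>A\<^esub>" if "x \<in> carrier L" for x
      using h[OF that] hI[of "\<zero>\<^bsub>A\<^esub>" x] by auto
    then show ?thesis
      unfolding a_kernel_def' set_eq_iff mem_Collect_eq im_i L by (metis (no_types, lifting) L(1) g.map_zero mem_Collect_eq)
  qed
  moreover have "h ` carrier L = carrier A"
  proof -
    have "a \<in> h ` carrier L" if a: "a \<in> carrier A" for a
    proof -
      have fa: "f a \<in> carrier B" "g (f a) = \<zero>\<^bsub>C\<^esub>" using a short_exact_in_image_iff[OF ex, of "f a"] by auto
      then have "f a \<in> p ` carrier F" using p_surj by simp
      then obtain x where x: "x \<in> carrier F" "p x = f a" by auto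
      then show ?thesis using hI[OF a x(2)] fa by (intro image_eqI[of _ _ x]) (simp_all add: L)
    qed
    then show ?thesis using h by auto
  qed
  ultimately have "short_exact R K L A i h"
    unfolding short_exact_def using K L_module A.module_axioms i_inj by simp
  then show ?thesis by (simp only: L_def h_def[abs_def])
qed

text \<open>The free module presenting \<open>B\<close> also presents \<open>C\<close>, through
  \<open>g p\<close>.\<close>

lemma S_finitely_presented_quotient:
  fixes R :: "('a, 'r) ring_scheme"
  assumes ex: "short_exact R A B C f g" and S: "submonoid S R"
    and A: "S_finite R S A" and B: "S_finitely_presented R S B"
  shows "S_finitely_presented R S C"
proof -
  obtain K F :: "('a, nat \<Rightarrow> 'a) module" and i p where pres: "short_exact R K F B i p"
    and K: "S_finite R S K" and F: "finitely_generated R F" "free_module R F"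
    using B unfolding S_finitely_presented_def by blast
  interpret gp: linear_map R F C "\<lambda>x. g (p x)"
    by (rule linear_map_compose[OF short_exact_linear_map(2)[OF pres] short_exact_linear_map(2)[OF ex]])
  have "S_finite R S (F\<lparr>carrier := a_kernel F C (\<lambda>x. g (p x))\<rparr>)"
    using S_finite_extension[OF short_exact_kernel_compose[OF ex pres] S K A] .
  moreover have "(\<lambda>x. g (p x)) ` carrier F = carrier C"
    using ex pres by (simp add: short_exact_def image_image[symmetric])
  ultimately show ?thesis
    unfolding S_finitely_presented_def using gp.short_exact_kernel F by blast
qed

text \<open>With \<open>{1}\<close> as multiplicative set, stability of finite generation under
  extensions is read off from that of S-finiteness.\<close>

lemma (in module) finitely_generated_iff_S_finite:
  "finitely_generated R M \<longleftrightarrow> S_finite R {\<one>} M"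
proof
  assume "finitely_generated R M"
  moreover have "submonoid {\<one>} R" by unfold_locales auto
  ultimately show "S_finite R {\<one>} M" using S_finite_if_finitely_generated by blast
next
  assume "S_finite R {\<one>} M"
  then obtain X where X: "finite X" "X \<subseteq> carrier M" "\<forall>x\<in>carrier M. \<one> \<odot>\<^bsub>M\<^esub> x \<in> lin_span R M X"
    unfolding S_finite_iff by blast
  then have "lin_span R M X = carrier M" using lin_span_closed(1)[OF X(2)] by auto
  then show "finitely_generated R M" unfolding finitely_generated_def using X by blast
qed

lemma finitely_generated_extension:
  assumes ex: "short_exact R A B C f g"
    and "finitely_generated R A" and "finitely_generated R C"
  shows "finitely_generated R B"
proof -
  interpret A: module R A using ex by (simp add: short_exact_def)
  interpret B: module R B using ex by (simp add: short_exact_def)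
  interpret C: module R C using ex by (simp add: short_exact_def)
  have "submonoid {\<one>\<^bsub>R\<^esub>} R" by unfold_locales auto
  then show ?thesis
    using S_finite_extension[OF ex] assms
    unfolding A.finitely_generated_iff_S_finite B.finitely_generated_iff_S_finite
      C.finitely_generated_iff_S_finite by blast
qed

text \<open>\<open>S\<close> enters a presentation only through its kernel, so generation holds
  without multipliers. This provides the free cover of the middle module of an extension.\<close>

lemma S_finitely_presented_imp_finitely_generated:
  fixes R :: "('a, 'r) ring_scheme"
  assumes "S_finitely_presented R S M"
  shows "finitely_generated R M"
proof -
  obtain K F :: "('a, nat \<Rightarrow> 'a) module" and i p where pres: "short_exact R K F M i p"
    and F: "finitely_generated R F"
    using assms unfolding S_finitely_presented_def by blast
  interpret p: linear_map R F M p by (rule short_exact_linear_map[OF pres])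
  show ?thesis using p.finitely_generated_image[OF F] pres by (simp add: short_exact_def)
qed

section \<open>External direct sums\<close>

lemma direct_sum_simps [simp]:
  "finite I \<Longrightarrow> carrier (direct_sum I N) = (\<Pi>\<^sub>E i\<in>I. carrier (N i))"
  "\<zero>\<^bsub>direct_sum I N\<^esub> = (\<lambda>i\<in>I. \<zero>\<^bsub>N i\<^esub>)"
  "x \<oplus>\<^bsub>direct_sum I N\<^esub> y = (\<lambda>i\<in>I. x i \<oplus>\<^bsub>N i\<^esub> y i)"
  "a \<odot>\<^bsub>direct_sum I N\<^esub> x = (\<lambda>i\<in>I. a \<odot>\<^bsub>N i\<^esub> x i)"
  by (auto simp: direct_sum_def)

lemma module_direct_sum:
  assumes R: "cring R" and I: "finite I" and N: "\<And>i. i \<in> I \<Longrightarrow> module R (N i)"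
  shows "module R (direct_sum I N)"
proof (rule moduleI)
  note ab = N[THEN module.axioms(2)]
  note mon = ab[THEN abelian_group.axioms(1)]
  let ?D = "direct_sum I N"
  show "abelian_group ?D"
  proof (rule abelian_groupI)
    fix x y assume xy: "x \<in> carrier ?D" "y \<in> carrier ?D"
    then show "x \<oplus>\<^bsub>?D\<^esub> y \<in> carrier ?D"
      using I by (auto simp: PiE_iff mon abelian_monoid.a_closed)
    from xy show "x \<oplus>\<^bsub>?D\<^esub> y = y \<oplus>\<^bsub>?D\<^esub> x"
      using I by (auto simp: PiE_iff mon intro!: restrict_ext abelian_monoid.a_comm)
    fix z assume "z \<in> carrier ?D"
    with xy show "(x \<oplus>\<^bsub>?D\<^esub> y) \<oplus>\<^bsub>?D\<^esub> z = x \<oplus>\<^bsub>?D\<^esub> (y \<oplus>\<^bsub>?D\<^esub> z)"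
      using I by (auto simp: PiE_iff mon abelian_monoid.a_assoc intro!: restrict_ext)
  next
    fix x assume x: "x \<in> carrier ?D"
    then show "\<zero>\<^bsub>?D\<^esub> \<oplus>\<^bsub>?D\<^esub> x = x"
      using I by (auto simp: fun_eq_iff PiE_iff extensional_def mon abelian_monoid.l_zero)
    from x show "\<exists>y\<in>carrier ?D. y \<oplus>\<^bsub>?D\<^esub> x = \<zero>\<^bsub>?D\<^esub>"
      using I by (intro bexI[of _ "\<lambda>i\<in>I. \<ominus>\<^bsub>N i\<^esub> x i"])
        (auto simp: fun_eq_iff PiE_iff ab abelian_group.l_neg abelian_group.a_inv_closed)
  qed (use I in \<open>auto simp: mon abelian_monoid.zero_closed\<close>)
qed (use R I in \<open>auto simp: fun_eq_iff PiE_iff extensional_def N[THEN module.smult_closed]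
      N[THEN module.smult_l_distr] N[THEN module.smult_r_distr] N[THEN module.smult_assoc1]
      N[THEN module.smult_one]\<close>)

text \<open>The old summands form the submodule, by extension with zero at the new index, and the
  new summand is the quotient. Inductions over the index set thus become iterated
  extensions.\<close>

lemma short_exact_direct_sum_insert:
  assumes R: "cring R" and I: "finite I" "i \<notin> I" and N: "\<And>j. j \<in> insert i I \<Longrightarrow> module R (N j)"
  shows "short_exact R (direct_sum I N) (direct_sum (insert i I) N) (N i)
           (\<lambda>x. x(i := \<zero>\<^bsub>N i\<^esub>)) (\<lambda>x. x i)"
proof -
  interpret Ni: module R "N i" using N by simp
  have zero: "\<zero>\<^bsub>N j\<^esub> \<in> carrier (N j)" if "j \<in> I" for j
    using N[of j] that by (simp add: module_def abelian_group_def abelian_monoid.zero_closed)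
  have "(\<lambda>x. x(i := \<zero>\<^bsub>N i\<^esub>)) \<in> linear_maps R (direct_sum I N) (direct_sum (insert i I) N)"
    using I by (auto simp: linear_maps_iff fun_eq_iff PiE_iff extensional_def)
  moreover have "(\<lambda>x. x i) \<in> linear_maps R (direct_sum (insert i I) N) (N i)"
    using I by (auto simp: linear_maps_iff)
  moreover have "inj_on (\<lambda>x. x(i := \<zero>\<^bsub>N i\<^esub>)) (carrier (direct_sum I N))"
    using I by (auto simp: inj_on_def PiE_iff extensional_def fun_eq_iff)
  moreover have "(\<lambda>x. x(i := \<zero>\<^bsub>N i\<^esub>)) ` carrier (direct_sum I N) =
      a_kernel (direct_sum (insert i I) N) (N i) (\<lambda>x. x i)" (is "?h ` ?A = ?K")
  proof
    show "?K \<subseteq> ?h ` ?A"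
    proof
      fix x assume "x \<in> ?K"
      \<comment> \<open>Because \<open>x i\<close> is zero, extending the restriction of
        \<open>x\<close> by zero recovers \<open>x\<close>.\<close>
      then have "x = ?h (restrict x I)" "restrict x I \<in> ?A"
        using I by (auto simp: a_kernel_def' PiE_iff extensional_def fun_eq_iff)
      then show "x \<in> ?h ` ?A" by blast
    qed
  qed (use I in \<open>auto simp: a_kernel_def' PiE_iff extensional_def\<close>)
  moreover have "(\<lambda>x. x i) ` carrier (direct_sum (insert i I) N) = carrier (N i)"
  proof
    show "carrier (N i) \<subseteq> (\<lambda>x. x i) ` carrier (direct_sum (insert i I) N)"
    proof
      fix a assume "a \<in> carrier (N i)"
      then have "(\<lambda>j\<in>insert i I. if j = i then a else \<zero>\<^bsub>N j\<^esub>) \<in> carrier (direct_sum (insert i I) N)"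
        using I zero by auto
      then show "a \<in> (\<lambda>x. x i) ` carrier (direct_sum (insert i I) N)"
        by (rule rev_image_eqI) simp
    qed
  qed (use I in auto)
  moreover have "module R (direct_sum I N)" "module R (direct_sum (insert i I) N)"
    using R I N by (auto intro: module_direct_sum)
  ultimately show ?thesis
    unfolding short_exact_def using Ni.module_axioms by blast
qed

section \<open>Free modules of finite rank\<close>

definition self_module :: "('a, 'r) ring_scheme \<Rightarrow> ('a, 'a) module" where
  "self_module R = \<lparr>carrier = carrier R, mult = mult R, one = one R, zero = zero R, add = add R,
     smult = mult R\<rparr>"

lemma self_module_simps [simp]:
  "carrier (self_module R) = carrier R" "\<zero>\<^bsub>self_module R\<^esub> = \<zero>\<^bsub>R\<^esub>"
  "x \<oplus>\<^bsub>self_module R\<^esub> y = x \<oplus>\<^bsub>R\<^esub> y" "a \<odot>\<^bsub>self_module R\<^esub> x = a \<otimes>\<^bsub>R\<^esub> x"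
  by (simp_all add: self_module_def)

lemma (in cring) module_self_module: "module R (self_module R)"
proof (rule moduleI)
  show "abelian_group (self_module R)"
    by (rule abelian_groupI) (auto simp: a_ac intro!: bexI[of _ "\<ominus> x" for x] r_neg)
qed (auto simp: l_distr r_distr m_assoc is_cring)

text \<open>Powers of the regular module have the carrier type prescribed for \<open>F\<close> in
  \<open>S_finitely_presented\<close>, and they inherit the module laws from direct sums.\<close>

abbreviation free_power :: "('a, 'r) ring_scheme \<Rightarrow> nat \<Rightarrow> ('a, nat \<Rightarrow> 'a) module" where
  "free_power R n \<equiv> direct_sum {..<n} (\<lambda>_. self_module R)"

definition unit_vector :: "('a, 'r) ring_scheme \<Rightarrow> nat \<Rightarrow> nat \<Rightarrow> nat \<Rightarrow> 'a" where
  "unit_vector R n i = (\<lambda>j\<in>{..<n}. if j = i then \<one>\<^bsub>R\<^esub> else \<zero>\<^bsub>R\<^esub>)"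

lemma (in cring) module_free_power: "module R (free_power R n)"
  by (intro module_direct_sum is_cring module_self_module) simp

lemma (in cring) unit_vector_closed: "unit_vector R n i \<in> carrier (free_power R n)"
  by (auto simp: unit_vector_def)

lemma (in module) finsum_in_submodule:
  assumes H: "submodule H R M" and v: "v \<in> T \<rightarrow> H"
  shows "(\<Oplus>\<^bsub>M\<^esub>b\<in>T. v b) \<in> H"
proof (cases "finite T")
  case True
  have HM: "H \<subseteq> carrier M" using H by (simp add: submodule_iff)
  show ?thesis using True v
  proof (induction T)
    case (insert b T)
    then have "v b \<in> carrier M" "v \<in> T \<rightarrow> carrier M" using HM by auto
    then show ?case using insert H by (simp add: submodule_iff)
  qed (use H in \<open>simp add: submodule_iff\<close>)
qed (use H in \<open>simp add: submodule_iff\<close>)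

lemma (in cring) inj_on_unit_vector:
  assumes "\<one> \<noteq> \<zero>"
  shows "inj_on (unit_vector R n) {..<n}"
proof (rule inj_onI)
  fix i j assume i: "i \<in> {..<n}" and eq: "unit_vector R n i = unit_vector R n j"
  from fun_cong[OF eq, of i] i assms show "i = j"
    by (simp add: unit_vector_def split: if_splits)
qed

text \<open>Evaluation at \<open>j\<close> is linear, so it can be applied term by term, and only
  the term of \<open>unit_vector R n j\<close> survives. Coefficients are indexed by the vectors
  themselves, so these have to be distinct; this is where \<open>1\<close> and \<open>0\<close> must
  differ.\<close>

lemma (in cring) lin_comb_unit_vectors:
  assumes "\<one> \<noteq> \<zero>" and c: "c \<in> unit_vector R n ` {..<n} \<rightarrow> carrier R"
  shows "lin_comb R (free_power R n) (\<lambda>b. b) (unit_vector R n ` {..<n}) c =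
           (\<lambda>j\<in>{..<n}. c (unit_vector R n j))"
proof -
  interpret P: module R "free_power R n" by (rule module_free_power)
  interpret S: module R "self_module R" by (rule module_self_module)
  let ?E = "unit_vector R n ` {..<n}"
  have inj: "unit_vector R n i = unit_vector R n j \<longleftrightarrow> i = j" if "i < n" "j < n" for i j
    using that inj_on_unit_vector[OF assms(1), of n] by (auto simp: inj_on_def)
  have E: "(\<lambda>b. b) \<in> ?E \<rightarrow> carrier (free_power R n)" using unit_vector_closed by blast
  have "lin_comb R (free_power R n) (\<lambda>b. b) ?E c j = c (unit_vector R n j)" if j: "j < n" for j
  proof -
    interpret coord: linear_map R "free_power R n" "self_module R" "\<lambda>x. x j"
      using j by unfold_locales (auto simp: linear_maps_iff)
    have "lin_comb R (free_power R n) (\<lambda>b. b) ?E c j = lin_comb R (self_module R) (\<lambda>b. b j) ?E c"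
      by (rule coord.map_lin_comb[OF E c])
    also have "\<dots> = (\<Oplus>\<^bsub>self_module R\<^esub>b\<in>?E. c b \<odot>\<^bsub>self_module R\<^esub> b j)"
      using E c j by (intro S.lin_comb_superset) (auto simp: unit_vector_def)
    also have "\<dots> = (\<Oplus>\<^bsub>self_module R\<^esub>b\<in>?E. if unit_vector R n j = b then c b else \<zero>\<^bsub>self_module R\<^esub>)"
    proof (rule S.M.finsum_cong')
      fix b assume "b \<in> ?E"
      then obtain i where i: "i < n" "b = unit_vector R n i" by auto
      then have "c b \<in> carrier R" using c by auto
      moreover have "b j = (if unit_vector R n j = b then \<one> else \<zero>)"
        using i j by (simp add: inj) (simp add: unit_vector_def)
      ultimately show "c b \<odot>\<^bsub>self_module R\<^esub> b j =
          (if unit_vector R n j = b then c b else \<zero>\<^bsub>self_module R\<^esub>)" by simp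
    qed (use c in auto)
    also have "\<dots> = c (unit_vector R n j)"
      using j c by (intro S.M.finsum_singleton) auto
    finally show ?thesis .
  qed
  \<comment> \<open>Outside \<open>{..<n}\<close> both sides are \<open>undefined\<close>.\<close>
  moreover have "lin_comb R (free_power R n) (\<lambda>b. b) ?E c \<in> extensional {..<n}"
    using P.lin_comb_closed[OF E c] by (simp add: PiE_def)
  ultimately show ?thesis by (auto simp: fun_eq_iff extensional_def)
qed

text \<open>\<open>free_module\<close> does not record that a basis is finite. This version does,
  and gives both freeness and finite generation of the powers.\<close>

lemma (in cring) free_power_basis:
  obtains E where "finite E" "E \<subseteq> carrier (free_power R n)"
    "\<forall>x\<in>carrier (free_power R n). \<exists>!c. c \<in> E \<rightarrow>\<^sub>E carrier R \<and>
        finite {b \<in> E. c b \<noteq> \<zero>} \<and> x = lin_comb R (free_power R n) (\<lambda>b. b) E c"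
proof (cases "\<one> = \<zero>")
  \<comment> \<open>Over the zero ring all unit vectors coincide, and the empty basis takes their place.\<close>
  case True
  then have "carrier R = {\<zero>}" by (simp add: carrier_one_zero)
  then have "x = (\<lambda>i\<in>{..<n}. \<zero>)" if "x \<in> carrier (free_power R n)" for x
    using that by (auto simp: PiE_iff extensional_def fun_eq_iff)
  moreover have "lin_comb R (free_power R n) (\<lambda>b. b) {} c = (\<lambda>i\<in>{..<n}. \<zero>)" for c
  proof -
    interpret P: module R "free_power R n" by (rule module_free_power)
    show ?thesis by (simp add: lin_comb_def)
  qed
  \<comment> \<open>On the empty basis the only extensional coefficient family is the constant
    \<open>undefined\<close>.\<close>
  ultimately have basis: "\<exists>!c. c \<in> {} \<rightarrow>\<^sub>E carrier R \<and> finite {b \<in> {}. c b \<noteq> \<zero>} \<and>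
      x = lin_comb R (free_power R n) (\<lambda>b. b) {} c" if "x \<in> carrier (free_power R n)" for x
    using that by (intro ex1I[of _ "\<lambda>_. undefined"]) simp_all
  show thesis by (rule that[of "{}"]) (simp, simp, intro ballI basis)
next
  case False
  define e where "e = unit_vector R n"
  have inj: "inj_on e {..<n}"
    unfolding e_def by (rule inj_on_unit_vector[OF False])
  have comb: "lin_comb R (free_power R n) (\<lambda>b. b) (e ` {..<n}) c = (\<lambda>j\<in>{..<n}. c (e j))"
    if "c \<in> e ` {..<n} \<rightarrow>\<^sub>E carrier R" for c
    using that lin_comb_unit_vectors[OF False, of c n] unfolding e_def by (simp add: PiE_def)
  have basis: "\<exists>!c. c \<in> e ` {..<n} \<rightarrow>\<^sub>E carrier R \<and> finite {b \<in> e ` {..<n}. c b \<noteq> \<zero>} \<and>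
      x = lin_comb R (free_power R n) (\<lambda>b. b) (e ` {..<n}) c" if x: "x \<in> carrier (free_power R n)" for x
  proof -
    \<comment> \<open>The coefficient of the basis vector \<open>e j\<close> is the entry
      \<open>x j\<close>; the index is recovered from the vector by inverting
      \<open>e\<close>.\<close>
    define c where "c = (\<lambda>b\<in>e ` {..<n}. x (inv_into {..<n} e b))"
    have ce: "c (e j) = x j" if "j < n" for j
      using that inj by (simp add: c_def)
    have c: "c \<in> e ` {..<n} \<rightarrow>\<^sub>E carrier R"
      unfolding c_def using x inj by (intro restrict_PiE_iff[THEN iffD2]) auto
    show ?thesis
    proof (intro ex1I[of _ c] conjI)
      show "x = lin_comb R (free_power R n) (\<lambda>b. b) (e ` {..<n}) c"
        unfolding comb[OF c] using x by (auto simp: fun_eq_iff ce PiE_iff extensional_def)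
    next
      fix d assume "d \<in> e ` {..<n} \<rightarrow>\<^sub>E carrier R \<and> finite {b \<in> e ` {..<n}. d b \<noteq> \<zero>} \<and>
        x = lin_comb R (free_power R n) (\<lambda>b. b) (e ` {..<n}) d"
      then have d: "d \<in> e ` {..<n} \<rightarrow>\<^sub>E carrier R" and xd: "x = (\<lambda>j\<in>{..<n}. d (e j))"
        using comb[of d] by blast+
      have "x j = d (e j)" if "j < n" for j unfolding xd using that by simp
      then show "d = c" by (intro PiE_ext[OF d c]) (auto simp: ce)
    qed (use c in simp_all)
  qed
  have "e ` {..<n} \<subseteq> carrier (free_power R n)"
    using unit_vector_closed unfolding e_def by blast
  then show thesis by (rule that[rotated]) (rule ballI, erule basis, simp)
qed

lemma (in cring) free_module_free_power: "free_module R (free_power R n)"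
  unfolding free_module_iff by (rule free_power_basis[of n]) (intro exI conjI)

lemma (in cring) finitely_generated_free_power: "finitely_generated R (free_power R n)"
proof -
  interpret P: module R "free_power R n" by (rule module_free_power)
  obtain E where E: "finite E" "E \<subseteq> carrier (free_power R n)"
    and basis: "\<forall>x\<in>carrier (free_power R n). \<exists>!c. c \<in> E \<rightarrow>\<^sub>E carrier R \<and>
        finite {b \<in> E. c b \<noteq> \<zero>} \<and> x = lin_comb R (free_power R n) (\<lambda>b. b) E c"
    by (rule free_power_basis)
  have "x \<in> lin_span R (free_power R n) E" if x: "x \<in> carrier (free_power R n)" for x
  proof -
    obtain c where c: "c \<in> E \<rightarrow>\<^sub>E carrier R" "x = lin_comb R (free_power R n) (\<lambda>b. b) E c"
      using basis[rule_format, OF x] by blast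
    have "b \<in> lin_span R (free_power R n) E" if "b \<in> E" for b using that by (rule hull_inc)
    then show ?thesis
      unfolding c(2) lin_comb_def using c(1) P.lin_span_closed(3)[OF E(2)]
      by (intro P.finsum_in_submodule P.submodule_lin_span E) auto
  qed
  then have "lin_span R (free_power R n) E = carrier (free_power R n)"
    using P.lin_span_closed(1)[OF E(2)] by blast
  then show ?thesis unfolding finitely_generated_def using E by blast
qed

text \<open>Indexing the generators by the numbers below \<open>n\<close> gives a linear map that
  sends the unit vectors to them; its image is a submodule containing the generators, hence
  everything.\<close>

lemma (in module) finitely_generated_cover:
  assumes "finitely_generated R M"
  obtains n p where "linear_map R (free_power R n) M p" "p ` carrier (free_power R n) = carrier M"
proof -
  obtain X where X: "finite X" "X \<subseteq> carrier M" "lin_span R M X = carrier M"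
    using assms unfolding finitely_generated_def by blast
  obtain n :: nat and y where y: "X = y ` {..<n}"
    using X(1) by (metis finite_imp_nat_seg_image_inj_on lessThan_def)
  have yM: "y i \<in> carrier M" if "i < n" for i using that X(2) y by auto
  define p where "p c = (\<Oplus>\<^bsub>M\<^esub>i\<in>{..<n}. c i \<odot>\<^bsub>M\<^esub> y i)" for c
  have "p \<in> linear_maps R (free_power R n) M"
    unfolding linear_maps_iff
  proof (intro conjI ballI)
    fix c assume c: "c \<in> carrier (free_power R n)"
    then show "p c \<in> carrier M" unfolding p_def using yM by (intro M.finsum_closed) auto
    fix d assume d: "d \<in> carrier (free_power R n)"
    have "p (c \<oplus>\<^bsub>free_power R n\<^esub> d) = (\<Oplus>\<^bsub>M\<^esub>i\<in>{..<n}. c i \<odot>\<^bsub>M\<^esub> y i \<oplus>\<^bsub>M\<^esub> d i \<odot>\<^bsub>M\<^esub> y i)"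
      unfolding p_def using c d yM by (intro M.finsum_cong') (auto simp: PiE_iff smult_l_distr)
    also have "\<dots> = p c \<oplus>\<^bsub>M\<^esub> p d"
      unfolding p_def using c d yM by (intro M.finsum_addf) auto
    finally show "p (c \<oplus>\<^bsub>free_power R n\<^esub> d) = p c \<oplus>\<^bsub>M\<^esub> p d" .
  next
    fix a c assume a: "a \<in> carrier R" and c: "c \<in> carrier (free_power R n)"
    have "p (a \<odot>\<^bsub>free_power R n\<^esub> c) = (\<Oplus>\<^bsub>M\<^esub>i\<in>{..<n}. a \<odot>\<^bsub>M\<^esub> (c i \<odot>\<^bsub>M\<^esub> y i))"
      unfolding p_def using a c yM by (intro M.finsum_cong') (auto simp: PiE_iff smult_assoc1)
    also have "\<dots> = a \<odot>\<^bsub>M\<^esub> p c"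
      unfolding p_def using a c yM by (intro finsum_smult_ldistr[symmetric]) auto
    finally show "p (a \<odot>\<^bsub>free_power R n\<^esub> c) = a \<odot>\<^bsub>M\<^esub> p c" .
  qed
  then interpret p: linear_map R "free_power R n" M p
    by (intro linear_map.intro linear_map_axioms.intro module_axioms module_free_power)
  have "p (unit_vector R n i) = y i" if "i < n" for i
  proof -
    have "p (unit_vector R n i) = (\<Oplus>\<^bsub>M\<^esub>j\<in>{..<n}. if i = j then y j else \<zero>\<^bsub>M\<^esub>)"
      unfolding p_def using yM by (intro M.finsum_cong') (auto simp: unit_vector_def)
    also have "\<dots> = y i" using that yM by (intro M.finsum_singleton) auto
    finally show ?thesis .
  qed
  then have "X \<subseteq> p ` carrier (free_power R n)"
    unfolding y using unit_vector_closed by (metis image_eqI image_subsetI lessThan_iff)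
  then have "lin_span R M X \<subseteq> p ` carrier (free_power R n)"
    using p.submodule_image[OF p.M.carrier_is_submodule] by (rule hull_minimal)
  moreover have "p ` carrier (free_power R n) \<subseteq> carrier M" using p.map_closed by blast
  ultimately have "p ` carrier (free_power R n) = carrier M" using X(3) by blast
  with p.linear_map_axioms show thesis by (rule that)
qed

text \<open>Cut out of a power of the ring, the kernel has the carrier type that the definition
  demands.\<close>

lemma S_finitely_presentedI:
  assumes "linear_map R (free_power R n) M h" and "h ` carrier (free_power R n) = carrier M"
    and "S_finite R S (free_power R n\<lparr>carrier := a_kernel (free_power R n) M h\<rparr>)"
  shows "S_finitely_presented R S M"
proof -
  interpret h: linear_map R "free_power R n" M h by fact
  show ?thesis
    unfolding S_finitely_presented_def
    using h.short_exact_kernel[OF assms(2)] assms(3) h.M.finitely_generated_free_power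
      h.M.free_module_free_power by blast
qed

section \<open>Extensions and direct sums\<close>

text \<open>Choosing an arbitrary cover of the middle module by a finitely generated free module avoids the
  horseshoe lemma: its kernel is \<open>S\<close>-finite by two applications of \<open>S_finite_kernel\<close>.\<close>

lemma S_finitely_presented_extension:
  assumes ex: "short_exact R A B C f g" and S: "submonoid S R"
    and A: "S_finitely_presented R S A" and C: "S_finitely_presented R S C"
  shows "S_finitely_presented R S B"
proof -
  interpret B: module R B using ex by (simp add: short_exact_def)
  interpret g: linear_map R B C g by (rule short_exact_linear_map[OF ex])
  have "finitely_generated R B"
    by (intro finitely_generated_extension[OF ex] S_finitely_presented_imp_finitely_generated[OF A]
        S_finitely_presented_imp_finitely_generated[OF C])
  then obtain n p where p: "linear_map R (free_power R n) B p"
    and p_surj: "p ` carrier (free_power R n) = carrier B"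
    by (rule B.finitely_generated_cover)
  interpret p: linear_map R "free_power R n" B p by (rule p)
  interpret gp: linear_map R "free_power R n" C "\<lambda>x. g (p x)"
    by (rule linear_map_compose[OF p g.linear_map_axioms])
  have gp_surj: "(\<lambda>x. g (p x)) ` carrier (free_power R n) = carrier C"
    using ex p_surj by (simp add: short_exact_def image_image[symmetric] del: direct_sum_simps)
  have "S_finite R S (free_power R n)"
    using p.M.S_finite_if_finitely_generated[OF S] B.finitely_generated_free_power by blast
  \<comment> \<open>First application: the middle term \<open>free_power R n\<close> is S-finite and
    the quotient \<open>C\<close> is S-finitely presented.\<close>
  then have "S_finite R S (free_power R n\<lparr>carrier := a_kernel (free_power R n) C (\<lambda>x. g (p x))\<rparr>)"
    using S_finite_kernel[OF gp.short_exact_kernel[OF gp_surj] S] C by blast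
  \<comment> \<open>Second application: the kernel of \<open>g p\<close> is now the middle term,
    between the kernel of \<open>p\<close> and the quotient \<open>A\<close>.\<close>
  then have "S_finite R S (free_power R n\<lparr>carrier := a_kernel (free_power R n) B p\<rparr>)"
    using S_finite_kernel[OF short_exact_kernel_compose[OF ex p.short_exact_kernel[OF p_surj]] S] A
    by blast
  then show ?thesis using S_finitely_presentedI[OF p p_surj] by blast
qed

section \<open>Finite direct sums\<close>

lemma finitely_generated_direct_sum_empty:
  assumes "cring R"
  shows "finitely_generated R (direct_sum {} N)"
proof -
  interpret module R "direct_sum {} N" by (rule module_direct_sum[OF assms]) auto
  have "lin_span R (direct_sum {} N) {} \<subseteq> carrier (direct_sum {} N)"
    by (rule lin_span_closed) simp
  moreover have "\<zero>\<^bsub>direct_sum {} N\<^esub> \<in> lin_span R (direct_sum {} N) {}"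
    using submodule_lin_span[of "{}"] submodule_iff by blast
  ultimately show ?thesis unfolding finitely_generated_def by (intro exI[of _ "{}"]) auto
qed

lemma S_finite_direct_sum:
  assumes R: "cring R" and S: "submonoid S R" and "finite I"
    and "\<forall>i\<in>I. module R (N i) \<and> S_finite R S (N i)"
  shows "S_finite R S (direct_sum I N)"
  using assms(3,4)
proof (induction I)
  case empty
  interpret module R "direct_sum {} N" by (rule module_direct_sum[OF R]) auto
  show ?case using S_finite_if_finitely_generated[OF S finitely_generated_direct_sum_empty[OF R]] .
next
  case (insert i I)
  then have ex: "short_exact R (direct_sum I N) (direct_sum (insert i I) N) (N i)
      (\<lambda>x. x(i := \<zero>\<^bsub>N i\<^esub>)) (\<lambda>x. x i)"
    by (intro short_exact_direct_sum_insert[OF R]) auto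
  have "S_finite R S (direct_sum I N)" using insert.IH insert.prems by simp
  moreover have "S_finite R S (N i)" using insert.prems by simp
  ultimately show ?case by (rule S_finite_extension[OF ex S])
qed

text \<open>A map to the zero module has its whole source as kernel, and
  \<open>free_power R n\<close> is finitely generated, hence S-finite.\<close>

lemma S_finitely_presented_direct_sum_empty:
  assumes R: "cring R" and S: "submonoid S R"
  shows "S_finitely_presented R S (direct_sum {} N)"
proof -
  let ?D = "direct_sum {} N"
  interpret D: module R ?D by (rule module_direct_sum[OF R]) auto
  obtain n p where p: "linear_map R (free_power R n) ?D p"
    and p_surj: "p ` carrier (free_power R n) = carrier ?D"
    by (rule D.finitely_generated_cover[OF finitely_generated_direct_sum_empty[OF R]])
  interpret p: linear_map R "free_power R n" ?D p by (rule p)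
  have "p x = \<zero>\<^bsub>?D\<^esub>" if "x \<in> carrier (free_power R n)" for x
    using p.map_closed[OF that] D.zero_closed by simp
  then have "a_kernel (free_power R n) ?D p = carrier (free_power R n)"
    unfolding a_kernel_def' by blast
  moreover have "S_finite R S (free_power R n)"
    using p.M.S_finite_if_finitely_generated[OF S] D.finitely_generated_free_power by blast
  \<comment> \<open>The kernel occurs as a record with replaced carrier; replacing the carrier by
    itself changes nothing.\<close>
  moreover have "free_power R n\<lparr>carrier := carrier (free_power R n)\<rparr> = free_power R n"
    by (rule module.equality) simp_all
  ultimately show ?thesis
    by (intro S_finitely_presentedI[OF p p_surj]) (simp only:)
qed

lemma S_finitely_presented_direct_sum:
  assumes R: "cring R" and S: "submonoid S R" and "finite I"
    and "\<forall>i\<in>I. module R (N i) \<and> S_finitely_presented R S (N i)"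
  shows "S_finitely_presented R S (direct_sum I N)"
  using assms(3,4)
proof (induction I)
  case empty
  show ?case by (rule S_finitely_presented_direct_sum_empty[OF R S])
next
  case (insert i I)
  then have ex: "short_exact R (direct_sum I N) (direct_sum (insert i I) N) (N i)
      (\<lambda>x. x(i := \<zero>\<^bsub>N i\<^esub>)) (\<lambda>x. x i)"
    by (intro short_exact_direct_sum_insert[OF R]) auto
  have "S_finitely_presented R S (direct_sum I N)" using insert.IH insert.prems by simp
  moreover have "S_finitely_presented R S (N i)" using insert.prems by simp
  ultimately show ?case by (rule S_finitely_presented_extension[OF ex S])
qed

theorem theorem2p5:
  fixes R :: "('a, 'r) ring_scheme"
    and S :: "'a set"
    and M' :: "('a, 'b, 'm1) module_scheme"
    and M :: "('a, 'c, 'm2) module_scheme"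
    and M'' :: "('a, 'd, 'm3) module_scheme"
    and f :: "'b \<Rightarrow> 'c"
    and g :: "'c \<Rightarrow> 'd"
  assumes "cring R"
    and "submonoid S R"
    and "short_exact R M' M M'' f g"
  shows
    "((S_finite R S M' \<and> S_finite R S M'' \<longrightarrow> S_finite R S M) \<and>
      (\<forall>(I :: 'i set) (N :: 'i \<Rightarrow> ('a, 'e, 'n) module_scheme).
         finite I \<and> (\<forall>i\<in>I. module R (N i) \<and> S_finite R S (N i)) \<longrightarrow>
         S_finite R S (direct_sum I N))) \<and>
     ((S_finitely_presented R S M' \<and> S_finitely_presented R S M'' \<longrightarrow>
         S_finitely_presented R S M) \<and>
      (\<forall>(I :: 'i set) (N :: 'i \<Rightarrow> ('a, 'e, 'n) module_scheme).
         finite I \<and> (\<forall>i\<in>I. module R (N i) \<and> S_finitely_presented R S (N i)) \<longrightarrow>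
         S_finitely_presented R S (direct_sum I N))) \<and>
     ((S_finite R S M \<longrightarrow> S_finite R S M'') \<and>
      (\<forall>(P :: ('a, 'e, 'n) module_scheme) N.
         module R P \<and> S_finite R S P \<and> direct_summand N R P \<longrightarrow>
         S_finite R S (P\<lparr>carrier := N\<rparr>))) \<and>
     (S_finite R S M' \<and> S_finitely_presented R S M \<longrightarrow> S_finitely_presented R S M'') \<and>
     (S_finitely_presented R S M'' \<and> S_finite R S M \<longrightarrow> S_finite R S M')"
proof -
  interpret g: linear_map R M M'' g by (rule short_exact_linear_map[OF assms(3)])
  have S: "S \<subseteq> carrier R" using submonoid.subset[OF assms(2)] .
  have "g ` carrier M = carrier M''" using assms(3) by (simp add: short_exact_def)
  then show ?thesis
    using S_finite_extension[OF assms(3,2)] S_finite_direct_sum[OF assms(1,2)]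
      S_finitely_presented_extension[OF assms(3,2)] S_finitely_presented_direct_sum[OF assms(1,2)]
      g.S_finite_image[OF _ S] module.direct_summand_S_finite[OF _ _ S]
      S_finitely_presented_quotient[OF assms(3,2)] S_finite_kernel[OF assms(3,2)]
    by (intro conjI allI impI) blast+
qed

end
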